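(* Let $\mathbf{A}$ be a finite algebra, and suppose that $\mathrm{Con}(\mathbf{A})$ contains a pentagon $[\gamma,\delta,\theta]$ whose critical quotient is a covering $\delta\prec\theta$ with $\mathrm{typ}(\delta,\theta)=\mathbf{i}$. If $\mathbf{i}\neq\mathbf{1}$ and $U$ is a $\langle\delta,\theta\rangle$-minimal set, then $U$ has nonempty tail.
   Context: This uses tame congruence theory (Hobby–McKenzie). For a finite algebra $\mathbf{A}$ and a covering pair $\delta\prec\theta$ in $\mathrm{Con}(\mathbf{A})$, a $\langle\delta,\theta\rangle$-minimal set is a set $U\subseteq A$ minimal under inclusion among all sets of the form $e(A)$, with $e$ an idempotent unary polynomial of $\mathbf{A}$, such that $\delta|_U\neq\theta|_U$. A trace of $U$ is a $\theta|_U$-class that is not a $\delta|_U$-class; the body $B$ of $U$ is the union of the traces, and the tail is $T=U\setminus B$. $\mathrm{typ}(\delta,\theta)\in\{\mathbf{1},\mathbf{2},\mathbf{3},\mathbf{4},\mathbf{5}\}$ is the tame congruence theory type of the covering. A pentagon $[\gamma,\delta,\theta]$ in a lattice is the five-element sublattice generated by $\gamma,\delta,\theta$ where $\delta<\theta$, $\gamma\vee\delta\ge\theta$ and $\gamma\wedge\theta\le\delta$; its critical quotient is $\langle\delta,\theta\rangle$. A pentagon of type $\mathbf{i}$ is one whose critical quotient is a covering of type $\mathbf{i}$. *)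

theory Defs
  imports Main
begin

(* A (universal) algebra: a universe together with a set of fundamental
   operations, each given with its arity; an operation of arity k acts on
   lists of length k. *)
record 'a alg =
  uni  :: "'a set"
  fops :: "(nat \<times> ('a list \<Rightarrow> 'a)) set"

definition is_algebra :: "'a alg \<Rightarrow> bool" where
  "is_algebra Al \<longleftrightarrow> uni Al \<noteq> {} \<and>
     (\<forall>(k, f) \<in> fops Al. \<forall>xs. length xs = k \<and> set xs \<subseteq> uni Al \<longrightarrow> f xs \<in> uni Al)"

definition finite_algebra :: "'a alg \<Rightarrow> bool" where
  "finite_algebra Al \<longleftrightarrow> is_algebra Al \<and> finite (uni Al)"

inductive_set polys :: "'a alg \<Rightarrow> nat \<Rightarrow> ('a list \<Rightarrow> 'a) set" for Al :: "'a alg" and n :: nat where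
  proj: "i < n \<Longrightarrow> (\<lambda>xs. xs ! i) \<in> polys Al n"
| const: "c \<in> uni Al \<Longrightarrow> (\<lambda>xs. c) \<in> polys Al n"
| app: "(k, f) \<in> fops Al \<Longrightarrow> length gs = k \<Longrightarrow> \<forall>g\<in>set gs. g \<in> polys Al n
        \<Longrightarrow> (\<lambda>xs. f (map (\<lambda>g. g xs) gs)) \<in> polys Al n"

definition agree :: "'a set \<Rightarrow> nat \<Rightarrow> ('a list \<Rightarrow> 'a) \<Rightarrow> ('a list \<Rightarrow> 'a) \<Rightarrow> bool" where
  "agree X n f g \<longleftrightarrow> (\<forall>xs. length xs = n \<and> set xs \<subseteq> X \<longrightarrow> f xs = g xs)"

definition is_congruence :: "'a alg \<Rightarrow> 'a rel \<Rightarrow> bool" where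
  "is_congruence Al \<theta> \<longleftrightarrow> equiv (uni Al) \<theta> \<and>
     (\<forall>(k, f) \<in> fops Al. \<forall>xs ys. length xs = k \<and> length ys = k \<and>
        list_all2 (\<lambda>x y. (x, y) \<in> \<theta>) xs ys \<longrightarrow> (f xs, f ys) \<in> \<theta>)"

definition Con :: "'a alg \<Rightarrow> 'a rel set" where
  "Con Al = {\<theta>. is_congruence Al \<theta>}"

definition con_join :: "'a alg \<Rightarrow> 'a rel \<Rightarrow> 'a rel \<Rightarrow> 'a rel" where
  "con_join Al \<alpha> \<beta> = \<Inter>{\<psi> \<in> Con Al. \<alpha> \<union> \<beta> \<subseteq> \<psi>}"

definition covers :: "'a alg \<Rightarrow> 'a rel \<Rightarrow> 'a rel \<Rightarrow> bool" where
  "covers Al \<delta> \<theta> \<longleftrightarrow> \<delta> \<in> Con Al \<and> \<theta> \<in> Con Al \<and> \<delta> \<subset> \<theta> \<and>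
     \<not> (\<exists>\<psi> \<in> Con Al. \<delta> \<subset> \<psi> \<and> \<psi> \<subset> \<theta>)"

definition is_pentagon :: "'a alg \<Rightarrow> 'a rel \<Rightarrow> 'a rel \<Rightarrow> 'a rel \<Rightarrow> bool" where
  "is_pentagon Al \<gamma> \<delta> \<theta> \<longleftrightarrow> \<gamma> \<in> Con Al \<and> \<delta> \<in> Con Al \<and> \<theta> \<in> Con Al \<and>
     \<delta> \<subset> \<theta> \<and> \<theta> \<subseteq> con_join Al \<gamma> \<delta> \<and> \<gamma> \<inter> \<theta> \<subseteq> \<delta>"

definition upoly :: "'a alg \<Rightarrow> ('a \<Rightarrow> 'a) \<Rightarrow> bool" where
  "upoly Al e \<longleftrightarrow> (\<exists>p \<in> polys Al 1. \<forall>x \<in> uni Al. e x = p [x])"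

definition idem_on :: "'a set \<Rightarrow> ('a \<Rightarrow> 'a) \<Rightarrow> bool" where
  "idem_on X e \<longleftrightarrow> (\<forall>x \<in> X. e (e x) = e x)"

definition restr :: "'a rel \<Rightarrow> 'a set \<Rightarrow> 'a rel" where
  "restr R U = R \<inter> (U \<times> U)"

definition idem_image :: "'a alg \<Rightarrow> 'a set \<Rightarrow> bool" where
  "idem_image Al U \<longleftrightarrow> (\<exists>e. upoly Al e \<and> idem_on (uni Al) e \<and> U = e ` uni Al)"

definition min_set :: "'a alg \<Rightarrow> 'a rel \<Rightarrow> 'a rel \<Rightarrow> 'a set \<Rightarrow> bool" where
  "min_set Al \<delta> \<theta> U \<longleftrightarrow> idem_image Al U \<and> restr \<delta> U \<noteq> restr \<theta> U \<and>
     (\<forall>V. idem_image Al V \<and> restr \<delta> V \<noteq> restr \<theta> V \<and> V \<subseteq> U \<longrightarrow> V = U)"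

definition traces :: "'a alg \<Rightarrow> 'a rel \<Rightarrow> 'a rel \<Rightarrow> 'a set \<Rightarrow> 'a set set" where
  "traces Al \<delta> \<theta> U = {N. N \<in> U // restr \<theta> U \<and> N \<notin> U // restr \<delta> U}"

definition body :: "'a alg \<Rightarrow> 'a rel \<Rightarrow> 'a rel \<Rightarrow> 'a set \<Rightarrow> 'a set" where
  "body Al \<delta> \<theta> U = \<Union>(traces Al \<delta> \<theta> U)"

definition tail :: "'a alg \<Rightarrow> 'a rel \<Rightarrow> 'a rel \<Rightarrow> 'a set \<Rightarrow> 'a set" where
  "tail Al \<delta> \<theta> U = U - body Al \<delta> \<theta> U"

definition induced :: "'a alg \<Rightarrow> 'a set \<Rightarrow> 'a alg" where
  "induced Al N = \<lparr> uni = N,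
     fops = {(m, p) | m p. p \<in> polys Al m \<and>
               (\<forall>xs. length xs = m \<and> set xs \<subseteq> N \<longrightarrow> p xs \<in> N)} \<rparr>"

(* quotient algebra A / theta (theta a congruence; operations act on
   representatives, well defined for congruences) *)
definition quot :: "'a alg \<Rightarrow> 'a rel \<Rightarrow> 'a set alg" where
  "quot Al \<theta> = \<lparr> uni = uni Al // \<theta>,
     fops = {(k, \<lambda>Cs. \<theta> `` {f (map (\<lambda>C. SOME x. x \<in> C) Cs)}) | k f. (k, f) \<in> fops Al} \<rparr>"

definition gset_alg :: "'b set \<Rightarrow> ('b \<Rightarrow> 'b) set \<Rightarrow> 'b alg" where
  "gset_alg X G = \<lparr> uni = X, fops = {(1, \<lambda>xs. g (hd xs)) | g. g \<in> G} \<rparr>"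

definition is_Gset :: "'b set \<Rightarrow> ('b \<Rightarrow> 'b) set \<Rightarrow> bool" where
  "is_Gset X G \<longleftrightarrow> (\<forall>g \<in> G. bij_betw g X X)"

definition poly_equiv :: "'b alg \<Rightarrow> 'b alg \<Rightarrow> bool" where
  "poly_equiv M1 M2 \<longleftrightarrow> uni M1 = uni M2 \<and>
     (\<forall>n f. (\<exists>p \<in> polys M1 n. agree (uni M1) n f p) \<longleftrightarrow> (\<exists>p \<in> polys M2 n. agree (uni M2) n f p))"

(* typ(delta, theta) = 1: the minimal algebra A|_N / delta|_N induced on a
   trace N of a <delta,theta>-minimal set is polynomially equivalent to a G-set
   (independent of the choice of U and N by tame congruence theory). *)
definition tct_type_one :: "'a alg \<Rightarrow> 'a rel \<Rightarrow> 'a rel \<Rightarrow> bool" where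
  "tct_type_one Al \<delta> \<theta> \<longleftrightarrow> (\<exists>U N. min_set Al \<delta> \<theta> U \<and> N \<in> traces Al \<delta> \<theta> U \<and>
     (\<exists>G. is_Gset (N // restr \<delta> N) G \<and>
        poly_equiv (quot (induced Al N) (restr \<delta> N)) (gset_alg (N // restr \<delta> N) G)))"

end

theory Submission
  imports Defs "HOL-Library.FuncSet"
begin

text \<open>Suppose the tail of \<open>U\<close> is empty, so that the traces cover \<open>U\<close>. A unary polynomial mapping
  \<open>U\<close> to itself either permutes \<open>U\<close> or collapses \<open>\<theta>\<close> into \<open>\<delta>\<close>.

  If for some binary polynomial \<open>f\<close> on \<open>U\<close> and some \<open>(c, d) \<in> \<theta>\<close> the map \<open>\<lambda>x. f x c\<close> is a permutation
  while \<open>\<lambda>x. f x d\<close> collapses, then there is only one trace. Hence \<open>\<theta>\<close> is total on \<open>U\<close>, so \<open>\<gamma> \<inter> \<theta> \<subseteq> \<delta>\<close>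
  gives \<open>\<gamma> \<subseteq> \<delta>\<close> on \<open>U\<close>, contradicting \<open>\<theta> \<subseteq> \<gamma> \<squnion> \<delta>\<close>.

  Otherwise, since the type is not \<open>1\<close>, the polynomials on each trace are not all essentially unary
  modulo \<open>\<delta>\<close>, which gives for every \<open>y\<close> in \<open>U\<close> a binary polynomial both of whose sections at \<open>y\<close> are
  permutations, and so one with unit \<open>y\<close> on \<open>U\<close>. These make \<open>\<gamma>\<close> and \<open>\<delta>\<close> permute on \<open>U\<close>, which excludes
  a pentagon.\<close>

section \<open>Polynomials and congruences\<close>

lemma polys_closed:
  assumes "is_algebra Al" "p \<in> polys Al n" "length xs = n" "set xs \<subseteq> uni Al"
  shows "p xs \<in> uni Al"
  using assms(2)
proof induction
  case (proj i)
  then show ?case using assms by (metis nth_mem subsetD)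
next
  case (const c)
  then show ?case by simp
next
  case (app k f gs)
  then have "length (map (\<lambda>g. g xs) gs) = k" "set (map (\<lambda>g. g xs) gs) \<subseteq> uni Al"
    by auto
  with app(1) assms(1) show ?case unfolding is_algebra_def by blast
qed

lemma polys_comp:
  assumes "p \<in> polys Al m" "length qs = m" "set qs \<subseteq> polys Al n"
  shows "(\<lambda>xs. p (map (\<lambda>q. q xs) qs)) \<in> polys Al n"
  using assms(1)
proof induction
  case (proj i)
  then have "(\<lambda>xs. map (\<lambda>q. q xs) qs ! i) = qs ! i" using assms(2) by auto
  then show ?case using proj assms by (metis nth_mem subsetD)
next
  case (const c)
  then show ?case by (rule polys.const)
next
  case (app k f gs)
  let ?hs = "map (\<lambda>g xs. g (map (\<lambda>q. q xs) qs)) gs"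
  have "(\<lambda>xs. f (map (\<lambda>h. h xs) ?hs)) \<in> polys Al n"
    by (rule polys.app[OF app(1)]) (use app in auto)
  then show ?case by (simp add: o_def)
qed

lemma polys_cong:
  assumes "\<theta> \<in> Con Al" "p \<in> polys Al n" "length xs = n" "list_all2 (\<lambda>x y. (x, y) \<in> \<theta>) xs ys"
  shows "(p xs, p ys) \<in> \<theta>"
  using assms(2)
proof induction
  case (proj i)
  then show ?case using assms by (simp add: list_all2_conv_all_nth)
next
  case (const c)
  then show ?case using assms(1)
    by (simp add: Con_def is_congruence_def equiv_def refl_on_def)
next
  case (app k f gs)
  have "list_all2 (\<lambda>x y. (x, y) \<in> \<theta>) (map (\<lambda>g. g xs) gs) (map (\<lambda>g. g ys) gs)"
    using app by (auto simp: list_all2_conv_all_nth)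
  with app(1,2) assms(1) show ?case
    unfolding Con_def is_congruence_def by fastforce
qed

lemma Con_equiv: "\<theta> \<in> Con Al \<Longrightarrow> equiv (uni Al) \<theta>"
  by (simp add: Con_def is_congruence_def)

lemma equiv_restr: "equiv A R \<Longrightarrow> U \<subseteq> A \<Longrightarrow> equiv U (restr R U)"
  unfolding restr_def by (elim equivE, intro equivI symI transI refl_onI)
    (auto dest: symD transD refl_onD)

lemma Con_inter: "\<alpha> \<in> Con Al \<Longrightarrow> \<beta> \<in> Con Al \<Longrightarrow> \<alpha> \<inter> \<beta> \<in> Con Al"
proof -
  assume a: "\<alpha> \<in> Con Al" "\<beta> \<in> Con Al"
  have "equiv (uni Al) (\<alpha> \<inter> \<beta>)"
    using Con_equiv[OF a(1)] Con_equiv[OF a(2)]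
    by (elim equivE, intro equivI sym_Int trans_Int) (auto simp: refl_on_def)
  moreover have "list_all2 (\<lambda>x y. (x, y) \<in> \<alpha>) xs ys \<and> list_all2 (\<lambda>x y. (x, y) \<in> \<beta>) xs ys"
    if "list_all2 (\<lambda>x y. (x, y) \<in> \<alpha> \<inter> \<beta>) xs ys" for xs ys
    using that by (auto simp: list_all2_conv_all_nth)
  ultimately show ?thesis
    using a unfolding Con_def is_congruence_def by fastforce
qed

text \<open>Telescoping through the lists whose first \<open>k\<close> entries come from
  \<open>ys\<close> and the others from \<open>xs\<close>. The step is demanded only at mixtures of
  the two lists, so a condition that all their entries satisfy is available there.\<close>

lemma coordinatewise:
  assumes "length xs = n" "length ys = n"
    and step: "\<And>i zs. i < n \<Longrightarrow> length zs = n \<Longrightarrow> (\<forall>j<n. zs ! j = xs ! j \<or> zs ! j = ys ! j) \<Longrightarrow>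
      P (zs[i := xs ! i]) \<Longrightarrow> P (zs[i := ys ! i])"
    and "P xs"
  shows "P ys"
proof -
  have "P (take k ys @ drop k xs)" if "k \<le> n" for k
    using that
  proof (induction k)
    case 0
    then show ?case using assms by simp
  next
    case (Suc k)
    let ?zs = "take k ys @ drop k xs"
    have 1: "?zs[k := xs ! k] = ?zs"
      by (rule nth_equalityI) (use assms Suc in \<open>auto simp: nth_append nth_list_update\<close>)
    have 2: "?zs[k := ys ! k] = take (Suc k) ys @ drop (Suc k) xs"
      by (rule nth_equalityI)
        (use assms Suc in \<open>auto simp: nth_append nth_list_update less_Suc_eq\<close>)
    have "P (?zs[k := ys ! k])"
      by (rule step) (use assms Suc 1 in \<open>auto simp: nth_append\<close>)
    then show ?case using 2 by simp
  qed
  from this[of n] show ?thesis using assms by simp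
qed

section \<open>Unary and binary polynomials as functions on the universe\<close>

definition bpoly :: "'a alg \<Rightarrow> ('a \<Rightarrow> 'a \<Rightarrow> 'a) \<Rightarrow> bool" where
  "bpoly Al f \<longleftrightarrow> (\<exists>p \<in> polys Al 2. \<forall>x \<in> uni Al. \<forall>y \<in> uni Al. f x y = p [x, y])"

lemma upoly_of_polys:
  assumes "p \<in> polys Al n" "length zs = n" "set zs \<subseteq> uni Al"
  shows "upoly Al (\<lambda>x. p (zs[i := x]))"
proof -
  let ?qs = "(map (\<lambda>c xs. c) zs)[i := \<lambda>xs. xs ! 0]"
  have "set ?qs \<subseteq> insert (\<lambda>xs. xs ! 0) ((\<lambda>c xs. c) ` set zs)"
    using set_update_subset_insert by fastforce
  also have "\<dots> \<subseteq> polys Al 1"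
    using assms(3) by (auto intro: polys.const polys.proj)
  finally have "(\<lambda>xs. p (map (\<lambda>q. q xs) ?qs)) \<in> polys Al 1"
    using assms by (intro polys_comp[where m = n]) auto
  moreover have "map (\<lambda>q. q [x]) ?qs = zs[i := x]" for x
    by (simp add: map_update o_def)
  ultimately show ?thesis unfolding upoly_def by (intro bexI) auto
qed

lemma bpoly_of_polys:
  assumes "p \<in> polys Al n" "length zs = n" "set zs \<subseteq> uni Al"
  shows "bpoly Al (\<lambda>x y. p (zs[i := x, j := y]))"
proof -
  let ?qs = "(map (\<lambda>c xs. c) zs)[i := \<lambda>xs. xs ! 0, j := \<lambda>xs. xs ! 1]"
  have "set ?qs \<subseteq> insert (\<lambda>xs. xs ! 1) (insert (\<lambda>xs. xs ! 0) ((\<lambda>c xs. c) ` set zs))"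
    using set_update_subset_insert by (metis (no_types, lifting) insert_mono list.set_map order_trans)
  also have "\<dots> \<subseteq> polys Al 2"
    using assms(3) by (auto intro: polys.const polys.proj)
  finally have "(\<lambda>xs. p (map (\<lambda>q. q xs) ?qs)) \<in> polys Al 2"
    using assms by (intro polys_comp[where m = n]) auto
  moreover have "map (\<lambda>q. q [x, y]) ?qs = zs[i := x, j := y]" for x y
    by (simp add: map_update o_def)
  ultimately show ?thesis unfolding bpoly_def by (intro bexI) auto
qed

lemma upoly_id: "upoly Al (\<lambda>x. x)"
  unfolding upoly_def by (rule bexI[OF _ polys.proj[of 0]]) auto

lemma bpoly_fst: "bpoly Al (\<lambda>x y. x)"
  unfolding bpoly_def by (rule bexI[OF _ polys.proj[of 0]]) auto

lemma bpoly_snd: "bpoly Al (\<lambda>x y. y)"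
  unfolding bpoly_def by (rule bexI[OF _ polys.proj[of 1]]) auto

lemma upoly_closed: "is_algebra Al \<Longrightarrow> upoly Al f \<Longrightarrow> x \<in> uni Al \<Longrightarrow> f x \<in> uni Al"
  unfolding upoly_def using polys_closed[of Al _ 1 "[x]"] by auto

lemma upoly_cong: "\<theta> \<in> Con Al \<Longrightarrow> upoly Al f \<Longrightarrow> (x, y) \<in> \<theta> \<Longrightarrow> (f x, f y) \<in> \<theta>"
proof -
  assume a: "\<theta> \<in> Con Al" "upoly Al f" "(x, y) \<in> \<theta>"
  then have "x \<in> uni Al" "y \<in> uni Al" using Con_equiv[of \<theta> Al] by (auto simp: equiv_def)
  with a show ?thesis unfolding upoly_def using polys_cong[of \<theta> Al _ 1 "[x]" "[y]"] by auto
qed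

lemma upoly_comp:
  assumes "is_algebra Al" "upoly Al f" "upoly Al g"
  shows "upoly Al (\<lambda>x. f (g x))"
proof -
  obtain p q where pq: "p \<in> polys Al 1" "q \<in> polys Al 1"
    "\<forall>x \<in> uni Al. f x = p [x]" "\<forall>x \<in> uni Al. g x = q [x]"
    using assms(2,3) unfolding upoly_def by auto
  have "(\<lambda>xs. p (map (\<lambda>q. q xs) [q])) \<in> polys Al 1"
    by (rule polys_comp) (use pq in auto)
  then show ?thesis
    unfolding upoly_def by (rule bexI[rotated]) (use pq upoly_closed[OF assms(1,3)] in auto)
qed

lemma upoly_funpow: "is_algebra Al \<Longrightarrow> upoly Al f \<Longrightarrow> upoly Al (f ^^ k)"
proof (induction k)
  case 0
  then show ?case using upoly_id by (simp add: id_def)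
next
  case (Suc k)
  then show ?case using upoly_comp[of Al f "f ^^ k"] by (simp add: o_def)
qed

lemma bpoly_closed: "is_algebra Al \<Longrightarrow> bpoly Al f \<Longrightarrow> x \<in> uni Al \<Longrightarrow> y \<in> uni Al \<Longrightarrow> f x y \<in> uni Al"
  unfolding bpoly_def using polys_closed[of Al _ 2 "[x, y]"] by auto

lemma bpoly_comp:
  assumes "is_algebra Al" "bpoly Al f" "bpoly Al g" "bpoly Al h"
  shows "bpoly Al (\<lambda>x y. f (g x y) (h x y))"
proof -
  obtain p q r where pq: "p \<in> polys Al 2" "q \<in> polys Al 2" "r \<in> polys Al 2"
    "\<forall>x \<in> uni Al. \<forall>y \<in> uni Al. f x y = p [x, y]" "\<forall>x \<in> uni Al. \<forall>y \<in> uni Al. g x y = q [x, y]"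
    "\<forall>x \<in> uni Al. \<forall>y \<in> uni Al. h x y = r [x, y]"
    using assms(2-) unfolding bpoly_def by auto
  have "(\<lambda>xs. p (map (\<lambda>q. q xs) [q, r])) \<in> polys Al 2"
    by (rule polys_comp[OF pq(1)]) (use pq in auto)
  then show ?thesis
    unfolding bpoly_def
    by (rule bexI[rotated])
      (use pq bpoly_closed[OF assms(1,3)] bpoly_closed[OF assms(1,4)] in auto)
qed

lemma upoly_bpoly:
  assumes "is_algebra Al" "upoly Al u" "bpoly Al f"
  shows "bpoly Al (\<lambda>x y. u (f x y))"
proof -
  obtain p q where pq: "p \<in> polys Al 1" "q \<in> polys Al 2"
    "\<forall>x \<in> uni Al. u x = p [x]" "\<forall>x \<in> uni Al. \<forall>y \<in> uni Al. f x y = q [x, y]"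
    using assms(2,3) unfolding upoly_def bpoly_def by auto
  have "(\<lambda>xs. p (map (\<lambda>q. q xs) [q])) \<in> polys Al 2"
    by (rule polys_comp) (use pq in auto)
  then show ?thesis
    unfolding bpoly_def
    by (rule bexI[rotated]) (use pq bpoly_closed[OF assms(1,3)] in auto)
qed

lemma bpoly_upoly:
  assumes "is_algebra Al" "bpoly Al f" "upoly Al u" "upoly Al v"
  shows "upoly Al (\<lambda>x. f (u x) (v x))"
proof -
  \<comment> \<open>A dummy second variable lets the binary composition apply; identifying the two
    variables afterwards gives the unary polynomial.\<close>
  have b: "bpoly Al (\<lambda>x y. f (u x) (v x))"
    by (rule bpoly_comp[OF assms(1,2) upoly_bpoly[OF assms(1,3) bpoly_fst]
          upoly_bpoly[OF assms(1,4) bpoly_fst]])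
  then obtain p where p: "p \<in> polys Al 2" "\<forall>x \<in> uni Al. \<forall>y \<in> uni Al. f (u x) (v x) = p [x, y]"
    unfolding bpoly_def by auto
  have "(\<lambda>xs. p (map (\<lambda>q. q xs) [\<lambda>xs. xs ! 0, \<lambda>xs. xs ! 0])) \<in> polys Al 1"
    by (rule polys_comp[OF p(1)]) (use p in \<open>auto intro: polys.proj\<close>)
  then show ?thesis unfolding upoly_def by (rule bexI[rotated]) (use p in auto)
qed

lemma upoly_const: "c \<in> uni Al \<Longrightarrow> upoly Al (\<lambda>x. c)"
  unfolding upoly_def by (rule bexI[OF _ polys.const[of c]]) auto

lemma bpoly_funpow:
  "is_algebra Al \<Longrightarrow> bpoly Al f \<Longrightarrow> bpoly Al (\<lambda>x y. ((\<lambda>z. f z y) ^^ k) x)"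
proof (induction k)
  case 0
  then show ?case using bpoly_fst by simp
next
  case (Suc k)
  then show ?case using bpoly_comp[OF Suc(2,3) Suc.IH bpoly_snd] by simp
qed

text \<open>Closure under unary polynomials is just composition, and this suffices for a congruence
  because the arguments of an operation can be changed one at a time. The lemma extends an
  equivalence on \<open>V\<close> to the whole algebra.\<close>

lemma Con_pullback:
  assumes "is_algebra Al" "equiv V R"
  shows "{(x, y). x \<in> uni Al \<and> y \<in> uni Al \<and>
      (\<forall>u. upoly Al u \<and> u ` uni Al \<subseteq> V \<longrightarrow> (u x, u y) \<in> R)} \<in> Con Al" (is "?P \<in> _")
proof -
  have refl: "(x, x) \<in> R" if "x \<in> V" for x using assms(2) that by (auto simp: equiv_def refl_on_def)
  have eq: "equiv (uni Al) ?P"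
  proof (rule equivI)
    show "refl_on (uni Al) ?P" using refl by (auto simp: refl_on_def)
    show "sym ?P" using assms(2) unfolding equiv_def sym_def by blast
    show "trans ?P" using assms(2) unfolding equiv_def trans_def by blast
  qed auto
  have up: "(w x, w y) \<in> ?P" if "(x, y) \<in> ?P" "upoly Al w" for w x y
  proof -
    have xy: "x \<in> uni Al" "y \<in> uni Al" using that by auto
    have "(u (w x), u (w y)) \<in> R" if u: "upoly Al u" "u ` uni Al \<subseteq> V" for u
      using \<open>(x, y) \<in> ?P\<close> upoly_comp[OF assms(1) u(1) \<open>upoly Al w\<close>] u(2)
        upoly_closed[OF assms(1) \<open>upoly Al w\<close>]
      by (force simp: image_subset_iff)
    then show ?thesis using xy upoly_closed[OF assms(1) that(2)] by auto
  qed
  have "(f xs, f ys) \<in> ?P"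
    if kf: "(k, f) \<in> fops Al" and l: "length xs = k" "length ys = k"
      and xy: "list_all2 (\<lambda>x y. (x, y) \<in> ?P) xs ys" for k f xs ys
  proof -
    \<comment> \<open>Feeding \<open>f\<close> the projections makes it a polynomial; the two agree
      on lists of length \<open>k\<close>, which are the only ones compared.\<close>
    let ?f = "\<lambda>xs. f (map (\<lambda>g. g xs) (map (\<lambda>i xs. xs ! i) [0..<k]))"
    have f: "?f \<in> polys Al k" by (rule polys.app[OF kf]) (auto intro: polys.proj)
    have f_eq: "?f zs = f zs" if "length zs = k" for zs
      using that map_nth[of zs] by (simp add: o_def)
    have xyi: "(xs ! i, ys ! i) \<in> ?P" if "i < k" for i
      using list_all2_nthD[OF xy] that l by blast
    have uni: "xs ! i \<in> uni Al" "ys ! i \<in> uni Al" if "i < k" for i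
      using xyi[OF that] by auto
    have "set xs \<subseteq> uni Al" using uni l by (auto simp: in_set_conv_nth)
    then have "f xs \<in> uni Al" using polys_closed[OF assms(1) f l(1)] f_eq l by metis
    then have "(f xs, f xs) \<in> ?P" using eq unfolding equiv_def refl_on_def by blast
    then have 0: "(?f xs, ?f xs) \<in> ?P" unfolding f_eq[OF l(1)] .
    have "(?f xs, ?f ys) \<in> ?P"
    proof (rule coordinatewise[of xs k ys "\<lambda>zs. (?f xs, ?f zs) \<in> ?P", OF l _ 0])
      fix i zs
      assume i: "i < k" and zs: "length zs = k" "\<forall>j<k. zs ! j = xs ! j \<or> zs ! j = ys ! j"
        and IH: "(?f xs, ?f (zs[i := xs ! i])) \<in> ?P"
      have "set zs \<subseteq> uni Al" using zs uni by (fastforce simp: in_set_conv_nth)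
      then have "upoly Al (\<lambda>x. ?f (zs[i := x]))" using upoly_of_polys[OF f] zs by blast
      from up[OF xyi[OF i] this] have "(?f (zs[i := xs ! i]), ?f (zs[i := ys ! i])) \<in> ?P" .
      with IH show "(?f xs, ?f (zs[i := ys ! i])) \<in> ?P" using eq unfolding equiv_def by (meson transD)
    qed
    then show ?thesis unfolding f_eq[OF l(1)] f_eq[OF l(2)] .
  qed
  then show ?thesis using eq unfolding Con_def is_congruence_def by blast
qed

text \<open>Pigeonhole: \<open>V\<close> has finitely many self-maps, so two different powers of
  \<open>g\<close> agree on \<open>V\<close>, and injectivity cancels the smaller one.\<close>

lemma funpow_eq_id_on:
  assumes "finite V" "inj_on g V" "g ` V \<subseteq> V"
  shows "\<exists>k>0. \<forall>x\<in>V. (g ^^ k) x = x"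
proof -
  have cl: "(g ^^ k) ` V \<subseteq> V" for k using assms(3) by (induction k) auto
  have inj: "inj_on (g ^^ k) V" for k
  proof (induction k)
    case (Suc k)
    have "inj_on g ((g ^^ k) ` V)" using assms(2) cl inj_on_subset by blast
    with Suc have "inj_on (g \<circ> (g ^^ k)) V" by (simp only: comp_inj_on)
    then show ?case by (simp only: funpow.simps)
  qed auto
  let ?r = "\<lambda>k. restrict (g ^^ k) V"
  have "range ?r \<subseteq> V \<rightarrow>\<^sub>E V" using cl by (auto simp: PiE_iff image_subset_iff)
  moreover have "finite (V \<rightarrow>\<^sub>E V)" using assms(1) by (intro finite_PiE)
  ultimately have "finite (range ?r)" by (rule finite_subset)
  then have "\<not> inj ?r" using finite_imageD infinite_UNIV_nat by blast
  then obtain i j where ij: "i < j" "?r i = ?r j"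
    unfolding inj_def by (metis linorder_neqE_nat)
  have "(g ^^ (j - i)) x = x" if "x \<in> V" for x
  proof -
    have "(g ^^ i) ((g ^^ (j - i)) x) = (g ^^ j) x"
      using ij(1) by (metis funpow_add comp_apply le_add_diff_inverse less_imp_le)
    also have "\<dots> = (g ^^ i) x" using ij(2) that by (metis restrict_apply')
    finally show ?thesis using inj[of i] cl[of "j - i"] that by (auto simp: inj_on_def)
  qed
  then show ?thesis using ij(1) by (intro exI[of _ "j - i"]) auto
qed

section \<open>Minimal sets\<close>

locale minimal_set =
  fixes Al :: "'a alg" and \<delta> \<theta> :: "'a rel" and U :: "'a set"
  assumes fin_alg: "finite_algebra Al"
    and cov: "covers Al \<delta> \<theta>"
    and min: "min_set Al \<delta> \<theta> U"
begin

lemma alg: "is_algebra Al" and fin: "finite (uni Al)"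
  using fin_alg by (auto simp: finite_algebra_def)

lemma Con_delta: "\<delta> \<in> Con Al" and Con_theta: "\<theta> \<in> Con Al" and delta_theta: "\<delta> \<subseteq> \<theta>"
  using cov by (auto simp: covers_def)

lemmas equiv_delta = Con_equiv[OF Con_delta] and equiv_theta = Con_equiv[OF Con_theta]

lemma delta_refl: "x \<in> uni Al \<Longrightarrow> (x, x) \<in> \<delta>"
  and delta_sym: "(x, y) \<in> \<delta> \<Longrightarrow> (y, x) \<in> \<delta>"
  and delta_trans: "(x, y) \<in> \<delta> \<Longrightarrow> (y, z) \<in> \<delta> \<Longrightarrow> (x, z) \<in> \<delta>"
  using equiv_delta unfolding equiv_def
  by (blast dest: refl_onD, blast dest: symD, blast dest: transD)

lemma theta_refl: "x \<in> uni Al \<Longrightarrow> (x, x) \<in> \<theta>"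
  and theta_sym: "(x, y) \<in> \<theta> \<Longrightarrow> (y, x) \<in> \<theta>"
  and theta_trans: "(x, y) \<in> \<theta> \<Longrightarrow> (y, z) \<in> \<theta> \<Longrightarrow> (x, z) \<in> \<theta>"
  using equiv_theta unfolding equiv_def
  by (blast dest: refl_onD, blast dest: symD, blast dest: transD)

text \<open>\<open>min_set\<close> only asserts that some idempotent polynomial has image
  \<open>U\<close>; one such retraction is fixed for the whole locale.\<close>

definition e :: "'a \<Rightarrow> 'a" where
  "e = (SOME e. upoly Al e \<and> idem_on (uni Al) e \<and> U = e ` uni Al)"

lemma e_upoly: "upoly Al e" and e_idem: "idem_on (uni Al) e" and e_image: "e ` uni Al = U"
proof -
  have "\<exists>e. upoly Al e \<and> idem_on (uni Al) e \<and> U = e ` uni Al"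
    using min by (auto simp: min_set_def idem_image_def)
  from someI_ex[OF this]
  show "upoly Al e" "idem_on (uni Al) e" "e ` uni Al = U" unfolding e_def by auto
qed

lemma U_sub: "U \<subseteq> uni Al"
  using e_image upoly_closed[OF alg e_upoly] by (metis image_subsetI)

lemma e_in: "x \<in> uni Al \<Longrightarrow> e x \<in> U"
  using e_image by (metis imageI)

lemma e_id: "x \<in> U \<Longrightarrow> e x = x"
  using e_image e_idem unfolding idem_on_def by (metis imageE)

lemma U_fin: "finite U"
  using fin U_sub finite_subset by blast

section \<open>Collapsing maps and the minimality of \<open>U\<close>\<close>

definition col :: "('a \<Rightarrow> 'a) \<Rightarrow> bool" where
  "col f \<longleftrightarrow> (\<forall>x\<in>U. \<forall>y\<in>U. (x, y) \<in> \<theta> \<longrightarrow> (f x, f y) \<in> \<delta>)"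

lemma colD: "col f \<Longrightarrow> x \<in> U \<Longrightarrow> y \<in> U \<Longrightarrow> (x, y) \<in> \<theta> \<Longrightarrow> (f x, f y) \<in> \<delta>"
  by (simp add: col_def)

text \<open>The pairs of \<theta> that polynomials into the image of \<open>h\<close> do not
  separate modulo \<delta> form a congruence between \<delta> and \<theta>. Since \<open>h\<close>
  separates \<open>(x, y)\<close>, the covering forces this congruence to be \<delta>, so
  \<open>(h x, h y)\<close> is separated too.\<close>

lemma noncollapsing_separated:
  assumes h: "upoly Al h" "(x, y) \<in> \<theta>" "(h x, h y) \<notin> \<delta>"
  obtains g where "upoly Al g" "g ` uni Al \<subseteq> h ` uni Al" "(g (h x), g (h y)) \<notin> \<delta>"
proof -
  let ?V = "h ` uni Al"
  let ?P = "{(x, y). x \<in> uni Al \<and> y \<in> uni Al \<and>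
      (\<forall>u. upoly Al u \<and> u ` uni Al \<subseteq> ?V \<longrightarrow> (u x, u y) \<in> restr \<delta> ?V)}"
  have "?V \<subseteq> uni Al" using upoly_closed[OF alg h(1)] by blast
  then have "?P \<inter> \<theta> \<in> Con Al"
    by (intro Con_inter Con_pullback alg equiv_restr[OF equiv_delta] Con_theta)
  moreover have "\<delta> \<subseteq> ?P \<inter> \<theta>"
  proof
    fix p assume p: "p \<in> \<delta>"
    obtain a b where ab: "p = (a, b)" by (cases p)
    have "a \<in> uni Al" "b \<in> uni Al" using p ab equiv_delta by (auto simp: equiv_def)
    with p ab delta_theta upoly_cong[OF Con_delta] show "p \<in> ?P \<inter> \<theta>"
      by (auto simp: restr_def)
  qed
  moreover have "(x, y) \<notin> ?P" using h by (auto simp: restr_def)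
  ultimately have "?P \<inter> \<theta> = \<delta>" using cov h(2) unfolding covers_def by blast
  moreover have "(h x, h y) \<in> \<theta>" using upoly_cong[OF Con_theta h(1,2)] .
  ultimately have "(h x, h y) \<notin> ?P" using h(3) by blast
  moreover have "h x \<in> uni Al" "h y \<in> uni Al"
    using \<open>(h x, h y) \<in> \<theta>\<close> equiv_theta by (auto simp: equiv_def)
  ultimately obtain u where u: "upoly Al u" "u ` uni Al \<subseteq> ?V" "(u (h x), u (h y)) \<notin> restr \<delta> ?V"
    by blast
  have "(u (h x), u (h y)) \<notin> \<delta>"
    using u(2,3) \<open>h x \<in> uni Al\<close> \<open>h y \<in> uni Al\<close> by (auto simp: restr_def)
  with u that show ?thesis by blast
qed

text \<open>An image that is minimal among all the noncollapsing polynomial images, not only the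
  idempotent ones, is already the image of an idempotent polynomial.\<close>

lemma noncollapsing_contains_idem_image:
  assumes f: "upoly Al f" "(x, y) \<in> \<theta>" "(f x, f y) \<notin> \<delta>"
  obtains V where "idem_image Al V" "restr \<delta> V \<noteq> restr \<theta> V" "V \<subseteq> f ` uni Al"
proof -
  define P where "P h \<longleftrightarrow> upoly Al h \<and> (\<exists>(x, y) \<in> \<theta>. (h x, h y) \<notin> \<delta>) \<and> h ` uni Al \<subseteq> f ` uni Al" for h
  have "P f" using f by (auto simp: P_def)
  then obtain h where h: "P h" "\<And>g. P g \<Longrightarrow> card (h ` uni Al) \<le> card (g ` uni Al)"
    using ex_has_least_nat[of P f "\<lambda>h. card (h ` uni Al)"] by blast
  obtain x y where xy: "(x, y) \<in> \<theta>" "(h x, h y) \<notin> \<delta>" using h(1) by (auto simp: P_def)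
  have hu: "upoly Al h" using h(1) by (simp add: P_def)
  obtain g where g: "upoly Al g" "g ` uni Al \<subseteq> h ` uni Al" "(g (h x), g (h y)) \<notin> \<delta>"
    using noncollapsing_separated[OF hu xy] .
  let ?V = "h ` uni Al"
  have V: "?V \<subseteq> uni Al" using upoly_closed[OF alg hu] by blast
  \<comment> \<open>\<open>g\<close> after \<open>h\<close> is a competitor with image inside
    \<open>?V\<close>, so least cardinality forces \<open>g\<close> to permute \<open>?V\<close>;
    some positive power of \<open>g\<close> is then the identity there.\<close>
  have "P (\<lambda>x. g (h x))"
    using g xy upoly_comp[OF alg g(1) hu] h(1) V unfolding P_def by blast
  from h(2)[OF this] have "card ?V \<le> card (g ` ?V)" by (simp add: image_image)
  moreover have gV: "g ` ?V \<subseteq> ?V" using g(2) V by blast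
  ultimately have "g ` ?V = ?V" using fin by (simp add: card_seteq)
  then have "inj_on g ?V" using fin by (simp add: eq_card_imp_inj_on)
  then obtain k where k: "k > 0" "\<forall>x\<in>?V. (g ^^ k) x = x"
    using funpow_eq_id_on[OF _ _ gV] fin by blast
  \<comment> \<open>Here \<open>k > 0\<close> matters: the outermost \<open>g\<close> sends the
    whole universe into \<open>?V\<close>, which makes the power idempotent with image
    \<open>?V\<close>.\<close>
  have gk: "(g ^^ k) x \<in> ?V" if "x \<in> uni Al" for x
  proof -
    obtain j where "k = Suc j" using k(1) gr0_implies_Suc by blast
    then show ?thesis using g(2) upoly_closed[OF alg upoly_funpow[OF alg g(1), of j] that] by auto
  qed
  have "?V = (g ^^ k) ` uni Al"
  proof
    show "?V \<subseteq> (g ^^ k) ` uni Al" 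
    proof
      fix v assume "v \<in> ?V"
      then show "v \<in> (g ^^ k) ` uni Al" using k(2) V by (intro image_eqI[of v _ v]) auto
    qed
    show "(g ^^ k) ` uni Al \<subseteq> ?V" using gk by blast
  qed
  then have "idem_image Al ?V"
    unfolding idem_image_def idem_on_def using upoly_funpow[OF alg g(1), of k] gk k(2)
    by (intro exI[of _ "g ^^ k"] conjI ballI) blast+
  moreover have "(h x, h y) \<in> restr \<theta> ?V - restr \<delta> ?V"
    using xy upoly_cong[OF Con_theta hu xy(1)] equiv_theta
    by (auto simp: restr_def equiv_def)
  ultimately show ?thesis using that[of ?V] h(1) by (auto simp: P_def)
qed

text \<open>Precomposed with the retraction \<open>e\<close>, the map \<open>f\<close> is a
  noncollapsing polynomial whose whole image lies in \<open>f\<close> of \<open>U\<close>. An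
  idempotent image inside it that still separates \<delta> from \<theta> must be \<open>U\<close> by
  minimality, and an onto self-map of a finite set is a bijection.\<close>

lemma noncol_bij:
  assumes "upoly Al f" "f ` U \<subseteq> U" "\<not> col f"
  shows "bij_betw f U U"
proof -
  obtain x y where xy: "x \<in> U" "y \<in> U" "(x, y) \<in> \<theta>" "(f x, f y) \<notin> \<delta>"
    using assms(3) by (auto simp: col_def)
  then have "(f (e x), f (e y)) \<notin> \<delta>" by (simp add: e_id)
  from noncollapsing_contains_idem_image[OF upoly_comp[OF alg assms(1) e_upoly] xy(3) this]
  obtain V where V: "idem_image Al V" "restr \<delta> V \<noteq> restr \<theta> V" "V \<subseteq> (\<lambda>x. f (e x)) ` uni Al" .
  have "V \<subseteq> f ` U" using V(3) e_in by blast
  then have "V \<subseteq> U" using assms(2) by (rule subset_trans)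
  with V(1,2) min have "V = U" unfolding min_set_def by auto
  with \<open>V \<subseteq> f ` U\<close> assms(2) have "f ` U = U" by blast
  then show ?thesis using U_fin by (simp add: bij_betw_def eq_card_imp_inj_on)
qed

text \<open>The inverse on \<open>U\<close> is a power of \<open>f\<close>, hence itself a
  polynomial.\<close>

lemma upoly_inverse:
  assumes "upoly Al f" "bij_betw f U U"
  obtains g where "upoly Al g" "g ` U \<subseteq> U" "\<And>x. x \<in> U \<Longrightarrow> g (f x) = x" "\<And>x. x \<in> U \<Longrightarrow> f (g x) = x"
proof -
  have fU: "f ` U \<subseteq> U" "inj_on f U" using assms(2) by (auto simp: bij_betw_def)
  obtain k where k: "k > 0" "\<forall>x\<in>U. (f ^^ k) x = x" using funpow_eq_id_on[OF U_fin fU(2,1)] by blast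
  then obtain j where j: "k = Suc j" using gr0_implies_Suc by blast
  have "(f ^^ j) ` U \<subseteq> U" for j using fU(1) by (induction j) auto
  moreover have "(f ^^ j) (f x) = x" "f ((f ^^ j) x) = x" if "x \<in> U" for x
    using k(2) that unfolding j by (auto simp: funpow_swap1)
  ultimately show ?thesis by (intro that[OF upoly_funpow[OF alg assms(1), of j]])
qed

lemma not_col_of_bij:
  assumes "upoly Al f" "bij_betw f U U" "x \<in> U" "y \<in> U" "(x, y) \<in> \<theta>" "(x, y) \<notin> \<delta>"
  shows "(f x, f y) \<notin> \<delta>"
  using upoly_inverse[OF assms(1,2)] upoly_cong[OF Con_delta] assms(3-) by metis

text \<open>The pullback of \<open>R\<close> along polynomials into \<open>U\<close> is a congruence
  above \<gamma> and \<delta>, hence above \<theta>. Since \<open>e\<close> maps into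
  \<open>U\<close> and fixes it pointwise, this pullback restricts into \<open>R\<close>. Statements
  about the join can thus be tested on \<open>U\<close> alone.\<close>

lemma theta_sub_of_equiv:
  assumes "\<theta> \<subseteq> con_join Al \<gamma> \<delta>" "\<gamma> \<in> Con Al" "equiv U R" "restr \<gamma> U \<subseteq> R" "restr \<delta> U \<subseteq> R"
  shows "restr \<theta> U \<subseteq> R"
proof -
  let ?P = "{(x, y). x \<in> uni Al \<and> y \<in> uni Al \<and>
      (\<forall>u. upoly Al u \<and> u ` uni Al \<subseteq> U \<longrightarrow> (u x, u y) \<in> R)}"
  have sub: "\<alpha> \<subseteq> ?P" if "\<alpha> \<in> Con Al" "restr \<alpha> U \<subseteq> R" for \<alpha>
  proof
    fix p assume p: "p \<in> \<alpha>"
    obtain x y where xy: "p = (x, y)" by (cases p)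
    have "x \<in> uni Al" "y \<in> uni Al" using p xy Con_equiv[OF that(1)] by (auto simp: equiv_def)
    moreover have "(u x, u y) \<in> R" if u: "upoly Al u" "u ` uni Al \<subseteq> U" for u
    proof -
      have "(u x, u y) \<in> \<alpha>" using upoly_cong[OF \<open>\<alpha> \<in> Con Al\<close> u(1)] p xy by blast
      moreover have "u x \<in> U" "u y \<in> U" using u(2) \<open>x \<in> uni Al\<close> \<open>y \<in> uni Al\<close> by auto
      ultimately show ?thesis using \<open>restr \<alpha> U \<subseteq> R\<close> unfolding restr_def by blast
    qed
    ultimately show "p \<in> ?P" by (simp add: xy)
  qed
  have "con_join Al \<gamma> \<delta> \<subseteq> ?P"
    unfolding con_join_def
    using Con_pullback[OF alg assms(3)] sub[OF assms(2,4)] sub[OF Con_delta assms(5)] by blast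
  then have "\<theta> \<subseteq> ?P" using assms(1) by blast
  show ?thesis
  proof
    fix p assume "p \<in> restr \<theta> U"
    then obtain x y where xy: "p = (x, y)" "x \<in> U" "y \<in> U" "(x, y) \<in> \<theta>" by (auto simp: restr_def)
    have "(e x, e y) \<in> R" using xy(4) \<open>\<theta> \<subseteq> ?P\<close> e_upoly e_image by blast
    then show "p \<in> R" using xy by (simp add: e_id)
  qed
qed

section \<open>Twin polynomials and the single trace\<close>

lemma theta_not_delta: obtains x y where "x \<in> U" "y \<in> U" "(x, y) \<in> \<theta>" "(x, y) \<notin> \<delta>"
  using min delta_theta by (auto simp: min_set_def restr_def)

lemma bpoly_section1: "bpoly Al f \<Longrightarrow> z \<in> U \<Longrightarrow> upoly Al (\<lambda>x. f x z)"
  using bpoly_upoly[OF alg _ upoly_id upoly_const[of z]] U_sub by blast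

lemma bpoly_section2: "bpoly Al f \<Longrightarrow> z \<in> U \<Longrightarrow> upoly Al (\<lambda>x. f z x)"
  using bpoly_upoly[OF alg _ upoly_const[of z] upoly_id] U_sub by blast

text \<open>The construction yields a binary polynomial \<open>p\<close> on \<open>U\<close> with \<open>p x x = p x a = x\<close>, so that
  \<open>p x\<close> collapses for \<open>x \<noteq> a\<close>; hence \<open>x\<close> is congruent to \<open>p x b\<close>, while \<open>\<lambda>x. p x b\<close> collapses.\<close>

lemma single_trace_of_twin:
  assumes f: "bpoly Al f" and f_cl: "\<And>x y. x \<in> U \<Longrightarrow> y \<in> U \<Longrightarrow> f x y \<in> U"
    and cd: "c \<in> U" "d \<in> U" "(c, d) \<in> \<theta>"
    and nc: "\<not> col (\<lambda>x. f x c)" and co: "col (\<lambda>x. f x d)"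
  obtains a where "a \<in> U"
    "\<And>x y. x \<in> U \<Longrightarrow> y \<in> U \<Longrightarrow> (x, y) \<in> \<theta> \<Longrightarrow> x \<noteq> a \<Longrightarrow> y \<noteq> a \<Longrightarrow> (x, y) \<in> \<delta>"
proof -
  have "bij_betw (\<lambda>x. f x c) U U"
    by (rule noncol_bij[OF bpoly_section1[OF f cd(1)] _ nc]) (use f_cl cd in auto)
  from upoly_inverse[OF bpoly_section1[OF f cd(1)] this]
  obtain g where g: "upoly Al g" "g ` U \<subseteq> U" "\<And>x. x \<in> U \<Longrightarrow> g (f x c) = x" by metis
  \<comment> \<open>Normalized so that \<open>c\<close> is a right unit on \<open>U\<close>, while
    the section at \<open>d\<close> still collapses.\<close>
  define f1 where "f1 x y = g (f x y)" for x y
  have f1: "bpoly Al f1" unfolding f1_def using upoly_bpoly[OF alg g(1) f] .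
  have f1_cl: "f1 x y \<in> U" if "x \<in> U" "y \<in> U" for x y
    unfolding f1_def using g(2) f_cl that by blast
  have f1c: "f1 x c = x" if "x \<in> U" for x unfolding f1_def using g(3) that by simp
  have f1d: "(f1 x d, f1 y d) \<in> \<delta>" if "x \<in> U" "y \<in> U" "(x, y) \<in> \<theta>" for x y
    unfolding f1_def using upoly_cong[OF Con_delta g(1) colD[OF co that]] .
  obtain u v where uv: "u \<in> U" "v \<in> U" "(u, v) \<in> \<theta>" "(u, v) \<notin> \<delta>" by (rule theta_not_delta)
  \<comment> \<open>If the section at \<open>d\<close> moved neither \<open>u\<close> nor
    \<open>v\<close> modulo \<delta>, its collapse would put \<open>(u, v)\<close> into
    \<delta>.\<close>
  have "(f1 u d, u) \<notin> \<delta> \<or> (f1 v d, v) \<notin> \<delta>"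
    using f1d[OF uv(1-3)] uv(4) delta_sym delta_trans by meson
  then obtain a where a: "a \<in> U" "(f1 a d, a) \<notin> \<delta>" using uv by blast
  define b where "b = f1 a d"
  have b: "b \<in> U" unfolding b_def using f1_cl a cd by simp
  have ab: "(a, b) \<in> \<theta>"
    using upoly_cong[OF Con_theta bpoly_section2[OF f1 a(1)] cd(3)] f1c[OF a(1)] by (simp add: b_def)
  \<comment> \<open>\<open>f1 a\<close> sends the \<theta>-pair \<open>(c, d)\<close> to
    \<open>(a, b)\<close>, which is not in \<delta>. So it permutes \<open>U\<close>, and its
    inverse \<open>s\<close> takes \<open>a\<close> to \<open>c\<close> and \<open>b\<close> to
    \<open>d\<close>.\<close>
  have "\<not> col (\<lambda>y. f1 a y)"
    using colD[of "f1 a" c d] cd a(2) f1c[OF a(1)] delta_sym by auto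
  then have "bij_betw (\<lambda>y. f1 a y) U U"
    by (intro noncol_bij bpoly_section2 f1 a) (use f1_cl a in auto)
  from upoly_inverse[OF bpoly_section2[OF f1 a(1)] this]
  obtain s where s: "upoly Al s" "s ` U \<subseteq> U" "\<And>x. x \<in> U \<Longrightarrow> s (f1 a x) = x"
      "\<And>x. x \<in> U \<Longrightarrow> f1 a (s x) = x" by metis
  have sa: "s a = c" using s(3)[OF cd(1)] f1c[OF a(1)] by simp
  have sb: "s b = d" using s(3)[OF cd(2)] by (simp add: b_def)
  \<comment> \<open>The diagonal of \<open>f1 x (s y)\<close>. It fixes \<open>a\<close> exactly and
    \<open>b\<close> modulo \<delta>, so it does not collapse; undoing it by its inverse
    \<open>r\<close> makes \<open>q\<close> below idempotent and keeps the collapse at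
    \<open>b\<close>.\<close>
  define \<pi> where "\<pi> x = f1 x (s x)" for x
  have \<pi>: "upoly Al \<pi>" unfolding \<pi>_def using bpoly_upoly[OF alg f1 upoly_id s(1)] .
  have "\<pi> a = a" by (simp add: \<pi>_def s(4) a)
  moreover have "(\<pi> b, b) \<in> \<delta>"
    unfolding \<pi>_def sb using f1d[OF b a(1) theta_sym[OF ab]] by (simp add: b_def)
  ultimately have "\<not> col \<pi>"
    using colD[of \<pi> a b] a b ab delta_sym delta_trans unfolding b_def by metis
  then have \<pi>_bij: "bij_betw \<pi> U U"
    by (intro noncol_bij \<pi>) (use f1_cl s(2) in \<open>auto simp: \<pi>_def\<close>)
  obtain r where r: "upoly Al r" "r ` U \<subseteq> U" "\<And>x. x \<in> U \<Longrightarrow> r (\<pi> x) = x"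
      "\<And>x. x \<in> U \<Longrightarrow> \<pi> (r x) = x"
    using upoly_inverse[OF \<pi> \<pi>_bij] by metis
  define q where "q x y = r (f1 x (s y))" for x y
  have q: "bpoly Al q"
    unfolding q_def
    by (rule upoly_bpoly[OF alg r(1) bpoly_comp[OF alg f1 bpoly_fst upoly_bpoly[OF alg s(1) bpoly_snd]]])
  have q_cl: "q x y \<in> U" if "x \<in> U" "y \<in> U" for x y
    unfolding q_def using r(2) s(2) f1_cl that by blast
  have qxx: "q x x = x" if "x \<in> U" for x using r(3)[OF that] by (simp add: q_def \<pi>_def)
  have qxa: "q x a = r x" if "x \<in> U" for x by (simp add: q_def sa f1c that)
  have qb: "(q x b, q y b) \<in> \<delta>" if "x \<in> U" "y \<in> U" "(x, y) \<in> \<theta>" for x y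
    unfolding q_def sb using upoly_cong[OF Con_delta r(1) f1d[OF that]] .
  \<comment> \<open>The section of \<open>q\<close> at \<open>a\<close> is the permutation
    \<open>r\<close>. Iterating \<open>q\<close> in its first variable turns this section into the
    identity; idempotence and the collapse at \<open>b\<close> survive.\<close>
  have "inj_on (\<lambda>x. q x a) U" 
  proof (rule inj_onI)
    fix x y assume xy: "x \<in> U" "y \<in> U" and "q x a = q y a"
    then have "\<pi> (r x) = \<pi> (r y)" by (simp add: qxa)
    then show "x = y" using r(4) xy by simp
  qed
  moreover have "(\<lambda>x. q x a) ` U \<subseteq> U" using q_cl a by blast
  ultimately obtain k where k: "k > 0" "\<forall>x\<in>U. ((\<lambda>x. q x a) ^^ k) x = x"
    using funpow_eq_id_on[OF U_fin] by blast
  define p where "p x y = ((\<lambda>z. q z y) ^^ k) x" for x y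
  have p: "bpoly Al p" unfolding p_def by (rule bpoly_funpow[OF alg q])
  have pow_cl: "((\<lambda>z. q z y) ^^ j) x \<in> U" if "x \<in> U" "y \<in> U" for x y j
    using that by (induction j) (auto simp: q_cl)
  have pxx: "p x x = x" if "x \<in> U" for x
    unfolding p_def by (induction k) (auto simp: qxx that)
  have pxa: "p x a = x" if "x \<in> U" for x using k(2) that by (simp add: p_def)
  have pb: "(p x b, p y b) \<in> \<delta>" if xy: "x \<in> U" "y \<in> U" "(x, y) \<in> \<theta>" for x y
  proof -
    \<comment> \<open>\<open>k > 0\<close> guarantees an innermost application of the section at
      \<open>b\<close>, which collapses; the remaining ones preserve \<delta>.\<close>
    obtain j where j: "k = Suc j" using k(1) gr0_implies_Suc by blast
    show ?thesis
      unfolding p_def j funpow_Suc_right o_apply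
      by (rule upoly_cong[OF Con_delta upoly_funpow[OF alg bpoly_section1[OF q b]] qb[OF xy]])
  qed
  have x_pxb: "(x, p x b) \<in> \<delta>" if "x \<in> U" "x \<noteq> a" for x
  proof -
    have "\<not> inj_on (\<lambda>y. p x y) U" using pxx pxa that a(1) by (metis inj_onD)
    then have "col (\<lambda>y. p x y)"
      using noncol_bij[OF bpoly_section2[OF p that(1)]] pow_cl that(1)
      unfolding bij_betw_def p_def by blast
    from colD[OF this a(1) b ab] show ?thesis using pxa[OF that(1)] by simp
  qed
  have "(x, y) \<in> \<delta>" if "x \<in> U" "y \<in> U" "(x, y) \<in> \<theta>" "x \<noteq> a" "y \<noteq> a" for x y
    using x_pxb[OF that(1,4)] x_pxb[OF that(2,5)] pb[OF that(1-3)] delta_sym delta_trans by meson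
  with a(1) that show ?thesis by blast
qed

lemma body_nontrivial:
  assumes "x \<in> body Al \<delta> \<theta> U"
  shows "\<exists>y\<in>U. (x, y) \<in> \<theta> \<and> (x, y) \<notin> \<delta>"
proof (rule ccontr)
  assume n: "\<not> ?thesis"
  obtain N where N: "x \<in> N" "N \<in> U // restr \<theta> U" "N \<notin> U // restr \<delta> U"
    using assms by (auto simp: body_def traces_def)
  have "equiv U (restr \<theta> U)" using equiv_restr[OF equiv_theta U_sub] .
  with N have "N = restr \<theta> U `` {x}" "x \<in> U"
    by (metis equiv_class_eq_iff Image_singleton_iff quotientE)+
  then have "N = restr \<delta> U `` {x}" using n delta_theta by (auto simp: restr_def)
  with \<open>x \<in> U\<close> N(3) show False by (simp add: quotientI)
qed

lemma no_twin:
  assumes tail: "tail Al \<delta> \<theta> U = {}" and pent: "is_pentagon Al \<gamma> \<delta> \<theta>"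
    and f: "bpoly Al f" and f_cl: "\<And>x y. x \<in> U \<Longrightarrow> y \<in> U \<Longrightarrow> f x y \<in> U"
    and cd: "c \<in> U" "d \<in> U" "(c, d) \<in> \<theta>" and nc: "\<not> col (\<lambda>x. f x c)"
  shows "\<not> col (\<lambda>x. f x d)"
proof
  assume "col (\<lambda>x. f x d)"
  from single_trace_of_twin[OF f f_cl cd nc this]
  obtain a where a: "a \<in> U"
    "\<And>x y. x \<in> U \<Longrightarrow> y \<in> U \<Longrightarrow> (x, y) \<in> \<theta> \<Longrightarrow> x \<noteq> a \<Longrightarrow> y \<noteq> a \<Longrightarrow> (x, y) \<in> \<delta>"
    by blast
  \<comment> \<open>With an empty tail every \<open>x\<close> lies in a \<theta>-pair outside
    \<delta>, and such a pair must contain \<open>a\<close>.\<close>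
  have xa: "(x, a) \<in> \<theta>" if "x \<in> U" for x
  proof -
    have "x \<in> body Al \<delta> \<theta> U" using tail that by (auto simp: tail_def)
    from body_nontrivial[OF this] obtain y where "y \<in> U" "(x, y) \<in> \<theta>" "(x, y) \<notin> \<delta>" by blast
    with a(2)[OF that] have "x = a \<or> y = a" by blast
    with \<open>(x, y) \<in> \<theta>\<close> a(1) theta_refl U_sub show ?thesis by blast
  qed
  have "restr \<gamma> U \<subseteq> restr \<delta> U"
  proof -
    have "(x, y) \<in> \<delta>" if "(x, y) \<in> \<gamma>" "x \<in> U" "y \<in> U" for x y
      using pent that theta_trans[OF xa theta_sym[OF xa]] unfolding is_pentagon_def by blast
    then show ?thesis by (auto simp: restr_def)
  qed
  moreover have "equiv U (restr \<delta> U)" by (rule equiv_restr[OF equiv_delta U_sub])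
  \<comment> \<open>Now both \<gamma> and \<delta> lie inside \<delta> on \<open>U\<close>, so the
    equivalence to pull back is \<delta> itself.\<close>
  ultimately have "restr \<theta> U \<subseteq> restr \<delta> U"
    using pent by (intro theta_sub_of_equiv[of \<gamma>]) (auto simp: is_pentagon_def)
  then show False using theta_not_delta unfolding restr_def by blast
qed

section \<open>Units and permuting congruences\<close>

text \<open>A binary polynomial with a unit \<open>y\<close> lets \<open>\<gamma>\<close> and \<open>\<delta>\<close> permute around the middle element \<open>y\<close>.\<close>

lemma no_units:
  assumes pent: "is_pentagon Al \<gamma> \<delta> \<theta>"
    and bij: "\<And>y. y \<in> U \<Longrightarrow> \<exists>f. bpoly Al f \<and> (\<forall>x\<in>U. \<forall>z\<in>U. f x z \<in> U) \<and>
      bij_betw (\<lambda>x. f x y) U U \<and> bij_betw (\<lambda>x. f y x) U U"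
  shows False
proof -
  have \<gamma>: "\<gamma> \<in> Con Al" "\<theta> \<subseteq> con_join Al \<gamma> \<delta>" "\<gamma> \<inter> \<theta> \<subseteq> \<delta>"
    using pent by (auto simp: is_pentagon_def)
  have gamma_refl: "x \<in> uni Al \<Longrightarrow> (x, x) \<in> \<gamma>"
    and gamma_sym: "(x, y) \<in> \<gamma> \<Longrightarrow> (y, x) \<in> \<gamma>"
    and gamma_trans: "(x, y) \<in> \<gamma> \<Longrightarrow> (y, z) \<in> \<gamma> \<Longrightarrow> (x, z) \<in> \<gamma>" for x y z
    using Con_equiv[OF \<gamma>(1)] unfolding equiv_def
    by (blast dest: refl_onD, blast dest: symD, blast dest: transD)
  have perm: "\<exists>w\<in>U. (x, w) \<in> \<delta> \<and> (w, z) \<in> \<gamma>"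
    if U: "x \<in> U" "y \<in> U" "z \<in> U" and xyz: "(x, y) \<in> \<gamma>" "(y, z) \<in> \<delta>" for x y z
  proof -
    obtain f where f: "bpoly Al f" and f_cl: "\<And>x z. x \<in> U \<Longrightarrow> z \<in> U \<Longrightarrow> f x z \<in> U"
      and fb: "bij_betw (\<lambda>x. f x y) U U" "bij_betw (\<lambda>x. f y x) U U"
      using bij[OF U(2)] by blast
    obtain g where g: "upoly Al g" "g ` U \<subseteq> U" "\<And>x. x \<in> U \<Longrightarrow> g (f x y) = x"
      "\<And>x. x \<in> U \<Longrightarrow> f (g x) y = x"
      using upoly_inverse[OF bpoly_section1[OF f U(2)] fb(1)] by metis
    obtain h where h: "upoly Al h" "h ` U \<subseteq> U" "\<And>x. x \<in> U \<Longrightarrow> h (f y x) = x"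
      "\<And>x. x \<in> U \<Longrightarrow> f y (h x) = x"
      using upoly_inverse[OF bpoly_section2[OF f U(2)] fb(2)] by metis
    \<comment> \<open>\<open>g\<close> and \<open>h\<close> undo the two sections of
      \<open>f\<close> at \<open>y\<close>. As \<open>h (f y y) = y\<close>, and
      \<open>f y (h v) = v\<close> for \<open>v\<close> in \<open>U\<close>, the element
      \<open>y\<close> is a two-sided unit of \<open>F\<close>.\<close>
    define F where "F x z = g (f x (h (f z y)))" for x z
    have hs: "upoly Al (\<lambda>z. h (f z y))" using upoly_comp[OF alg h(1) bpoly_section1[OF f U(2)]] .
    have F: "bpoly Al F"
      unfolding F_def
      by (rule upoly_bpoly[OF alg g(1) bpoly_comp[OF alg f bpoly_fst upoly_bpoly[OF alg hs bpoly_snd]]])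
    have "F x y = x" "F y z = z" using U by (simp_all add: F_def g h f_cl)
    moreover have "F x z \<in> U"
    proof -
      have "h (f z y) \<in> U" using h(2) f_cl U by blast
      with f_cl U(1) have "f x (h (f z y)) \<in> U" by blast
      then show ?thesis unfolding F_def using g(2) by blast
    qed
    \<comment> \<open>\<open>F x z\<close> is the required \<open>w\<close>: moving the second
      argument from \<open>y\<close> to \<open>z\<close> is a \<delta>-step, moving the first from
      \<open>x\<close> to \<open>y\<close> is a \<gamma>-step.\<close>
    moreover have "(F x y, F x z) \<in> \<delta>"
      using upoly_cong[OF Con_delta bpoly_section2[OF F U(1)] xyz(2)] .
    moreover have "(F x z, F y z) \<in> \<gamma>"
      using upoly_cong[OF \<gamma>(1) bpoly_section1[OF F U(3)] xyz(1)] .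
    ultimately show ?thesis by auto
  qed
  \<comment> \<open>The relational product of \<gamma> and \<delta> inside \<open>U\<close>;
    permutability makes it an equivalence, so it absorbs \<theta> on \<open>U\<close>.\<close>
  define R where "R = {(x, z). x \<in> U \<and> z \<in> U \<and> (\<exists>y\<in>U. (x, y) \<in> \<gamma> \<and> (y, z) \<in> \<delta>)}"
  have "equiv U R"
  proof (rule equivI)
    show "R \<subseteq> U \<times> U" by (auto simp: R_def)
    show "refl_on U R" using gamma_refl delta_refl U_sub unfolding R_def refl_on_def by blast
    show "sym R"
    proof (rule symI)
      fix x z assume "(x, z) \<in> R"
      then obtain y where "x \<in> U" "y \<in> U" "z \<in> U" "(x, y) \<in> \<gamma>" "(y, z) \<in> \<delta>" by (auto simp: R_def)
      with perm[OF this] show "(z, x) \<in> R" unfolding R_def using gamma_sym delta_sym by blast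
    qed
    show "trans R"
    proof (rule transI)
      fix x z v assume "(x, z) \<in> R" "(z, v) \<in> R"
      then obtain y u where xz: "x \<in> U" "y \<in> U" "z \<in> U" "(x, y) \<in> \<gamma>" "(y, z) \<in> \<delta>"
        and zv: "u \<in> U" "v \<in> U" "(z, u) \<in> \<gamma>" "(u, v) \<in> \<delta>" by (auto simp: R_def)
      from perm[OF zv(1) xz(3,2) gamma_sym[OF zv(3)] delta_sym[OF xz(5)]]
      obtain w where w: "w \<in> U" "(u, w) \<in> \<delta>" "(w, y) \<in> \<gamma>" by blast
      have "(x, w) \<in> \<gamma>" using gamma_trans[OF xz(4) gamma_sym[OF w(3)]] .
      moreover have "(w, v) \<in> \<delta>" using delta_trans[OF delta_sym[OF w(2)] zv(4)] .
      ultimately show "(x, v) \<in> R" using w(1) xz(1) zv(2) by (auto simp: R_def)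
    qed
  qed
  moreover have "restr \<gamma> U \<subseteq> R" "restr \<delta> U \<subseteq> R"
    using gamma_refl delta_refl U_sub unfolding restr_def R_def by blast+
  ultimately have sub: "restr \<theta> U \<subseteq> R" by (rule theta_sub_of_equiv[OF \<gamma>(2,1)])
  obtain x y where xy: "x \<in> U" "y \<in> U" "(x, y) \<in> \<theta>" "(x, y) \<notin> \<delta>" by (rule theta_not_delta)
  then obtain w where w: "(x, w) \<in> \<gamma>" "(w, y) \<in> \<delta>" using sub by (auto simp: restr_def R_def)
  \<comment> \<open>Staying inside one \<theta>-class puts the \<gamma>-step from \<open>x\<close>
    to \<open>w\<close> into \<gamma> \<inter> \<theta>, hence into \<delta>.\<close>
  have "(x, w) \<in> \<theta>" using theta_trans[OF xy(3) theta_sym] w(2) delta_theta by blast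
  with w \<gamma>(3) have "(x, w) \<in> \<delta>" by blast
  with w(2) xy(4) delta_trans show False by blast
qed

section \<open>Essentially unary polynomials and type 1\<close>

lemma trace_facts:
  assumes "N \<in> traces Al \<delta> \<theta> U"
  shows "N \<subseteq> U" "N \<noteq> {}" "\<And>x y. x \<in> N \<Longrightarrow> y \<in> N \<Longrightarrow> (x, y) \<in> \<theta>"
proof -
  have eq: "equiv U (restr \<theta> U)" and N: "N \<in> U // restr \<theta> U"
    using equiv_restr[OF equiv_theta U_sub] assms by (auto simp: traces_def)
  show "N \<subseteq> U" using in_quotient_imp_subset[OF eq N] .
  show "N \<noteq> {}" using in_quotient_imp_non_empty[OF eq N] .
  show "(x, y) \<in> \<theta>" if "x \<in> N" "y \<in> N" for x y
    using in_quotient_imp_in_rel[OF eq N, of x y] that by (auto simp: restr_def)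
qed

text \<open>The polynomials of a G-set are constants and permutations applied to one variable; this
  is the same shape modulo \<delta>, stated on representatives. Since \<open>h\<close> reflects
  \<delta>, it is injective on the \<delta>-classes of \<open>N\<close>, and finiteness makes it a
  permutation of them.\<close>

definition essentially_unary :: "'a set \<Rightarrow> nat \<Rightarrow> ('a list \<Rightarrow> 'a) \<Rightarrow> bool" where
  "essentially_unary N n q \<longleftrightarrow>
     (\<forall>zs ws. length zs = n \<and> set zs \<subseteq> N \<and> length ws = n \<and> set ws \<subseteq> N \<longrightarrow> (q zs, q ws) \<in> \<delta>) \<or>
     (\<exists>i<n. \<exists>h. upoly Al h \<and> h ` N \<subseteq> N \<and> (\<forall>x\<in>N. \<forall>y\<in>N. (h x, h y) \<in> \<delta> \<longrightarrow> (x, y) \<in> \<delta>) \<and>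
       (\<forall>zs. length zs = n \<and> set zs \<subseteq> N \<longrightarrow> (q zs, h (zs ! i)) \<in> \<delta>))"

text \<open>By \<open>twin\<close>, whether a variable collapses does not depend on the values in
  \<open>N\<close> of the others, and \<open>nonunit\<close> allows at most one noncollapsing
  variable. The others can be changed one at a time without leaving the \<delta>-class.\<close>

lemma essentially_unary_polys:
  assumes N: "N \<in> traces Al \<delta> \<theta> U" "y \<in> N"
    and twin: "\<And>f c d. bpoly Al f \<Longrightarrow> \<forall>x\<in>U. \<forall>z\<in>U. f x z \<in> U \<Longrightarrow> c \<in> U \<Longrightarrow> d \<in> U \<Longrightarrow>
      (c, d) \<in> \<theta> \<Longrightarrow> \<not> col (\<lambda>x. f x c) \<Longrightarrow> \<not> col (\<lambda>x. f x d)"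
    and nonunit: "\<And>f. bpoly Al f \<Longrightarrow> \<forall>x\<in>U. \<forall>z\<in>U. f x z \<in> U \<Longrightarrow>
      col (\<lambda>x. f x y) \<or> col (\<lambda>z. f y z)"
    and q: "q \<in> polys Al n" and q_cl: "\<And>zs. length zs = n \<Longrightarrow> set zs \<subseteq> N \<Longrightarrow> q zs \<in> N"
  shows "essentially_unary N n q"
proof -
  note NU = trace_facts(1)[OF N(1)] and Nth = trace_facts(3)[OF N(1)]
  \<comment> \<open>\<open>q\<close> is only known to preserve \<open>N\<close>; following it by
    \<open>e\<close> gives a polynomial that preserves \<open>U\<close> and agrees with
    \<open>q\<close> on \<open>N\<close>.\<close>
  define F where "F zs = e (q zs)" for zs
  have Fq: "F zs = q zs" if "length zs = n" "set zs \<subseteq> N" for zs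
    unfolding F_def using e_id q_cl[OF that] NU by blast
  have upd: "set (zs[i := x]) \<subseteq> A" if "set zs \<subseteq> A" "x \<in> A" for zs :: "'a list" and i x A
    using set_update_subset_insert[of zs i x] that by blast
  have F_cl: "F zs \<in> U" if "length zs = n" "set zs \<subseteq> U" for zs
    unfolding F_def using e_in polys_closed[OF alg q that(1)] that(2) U_sub by blast
  have F_u: "upoly Al (\<lambda>x. F (zs[i := x]))" if "length zs = n" "set zs \<subseteq> U" for zs i
    unfolding F_def using upoly_comp[OF alg e_upoly upoly_of_polys[OF q that(1)]] that(2) U_sub by blast
  have F_b: "bpoly Al (\<lambda>x z. F (zs[i := x, j := z]))" if "length zs = n" "set zs \<subseteq> U" for zs i j
    unfolding F_def using upoly_bpoly[OF alg e_upoly bpoly_of_polys[OF q that(1)]] that(2) U_sub by blast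
  have F_b_cl: "\<forall>x\<in>U. \<forall>z\<in>U. F (zs[i := x, j := z]) \<in> U" if "length zs = n" "set zs \<subseteq> U" for zs i j
    using F_cl upd that by (metis length_list_update)
  define nc where "nc i zs \<longleftrightarrow> \<not> col (\<lambda>x. F (zs[i := x]))" for i zs
  have transfer: "nc i ws"
    if zs: "length zs = n" "set zs \<subseteq> N" and ws: "length ws = n" "set ws \<subseteq> N" and "nc i zs" for i zs ws
  proof (rule coordinatewise[of zs n ws "nc i", OF zs(1) ws(1) _ \<open>nc i zs\<close>])
    fix j vs
    assume j: "j < n" and vs: "length vs = n" "\<forall>k<n. vs ! k = zs ! k \<or> vs ! k = ws ! k"
      and nc: "nc i (vs[j := zs ! j])"
    have zw: "zs ! k \<in> N" "ws ! k \<in> N" if "k < n" for k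
      using subsetD[OF zs(2) nth_mem] subsetD[OF ws(2) nth_mem] zs(1) ws(1) that by simp_all
    then have vsN: "set vs \<subseteq> N" using vs by (fastforce simp: in_set_conv_nth)
    show "nc i (vs[j := ws ! j])"
    proof (cases "i = j")
      case True
      then show ?thesis using nc by (simp add: nc_def)
    next
      case False
      \<comment> \<open>The two values at position \<open>j\<close> both lie in the trace
        \<open>N\<close>, hence in one \<theta>-class, so \<open>twin\<close> applies to the
        variables \<open>i\<close> and \<open>j\<close>.\<close>
      have "\<not> col (\<lambda>x. F (vs[i := x, j := ws ! j]))"
        by (rule twin[OF F_b F_b_cl, of vs "zs ! j"])
          (use vs vsN NU zw[OF j] Nth nc False in \<open>auto simp: nc_def list_update_swap\<close>)
      then show ?thesis using False by (simp add: nc_def list_update_swap)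
    qed
  qed
  \<comment> \<open>The base point: overwriting an entry by \<open>y\<close> leaves it unchanged, so
    two noncollapsing variables would be the two sections at \<open>y\<close> that
    \<open>nonunit\<close> forbids.\<close>
  define b where "b = replicate n y"
  have b: "length b = n" "set b \<subseteq> N" using N(2) by (auto simp: b_def)
  have bU: "set b \<subseteq> U" using b NU by blast
  have b_upd: "b[i := y] = b" for i unfolding b_def by (cases "i < n") (auto simp: list_update_same_conv list_update_beyond)
  have uniq: "i = j" if "nc i b" "nc j b" for i j
  proof (rule ccontr)
    assume "i \<noteq> j"
    then have "b[i := x, j := y] = b[i := x]" for x
      by (simp add: list_update_swap[of i j] b_upd)
    with nonunit[OF F_b[OF b(1) bU] F_b_cl[OF b(1) bU], of i j] that show False
      by (simp add: nc_def b_upd)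
  qed
  show ?thesis
  proof (cases "\<exists>i<n. nc i b")
    case False
    have "(q zs, q ws) \<in> \<delta>"
      if zs: "length zs = n" "set zs \<subseteq> N" and ws: "length ws = n" "set ws \<subseteq> N" for zs ws
    proof -
      have "(F zs, F ws) \<in> \<delta>"
      proof (rule coordinatewise[of zs n ws "\<lambda>vs. (F zs, F vs) \<in> \<delta>", OF zs(1) ws(1)])
        fix j vs
        assume j: "j < n" and vs: "length vs = n" "\<forall>k<n. vs ! k = zs ! k \<or> vs ! k = ws ! k"
          and IH: "(F zs, F (vs[j := zs ! j])) \<in> \<delta>"
        have zw: "zs ! k \<in> N" "ws ! k \<in> N" if "k < n" for k
      using subsetD[OF zs(2) nth_mem] subsetD[OF ws(2) nth_mem] zs(1) ws(1) that by simp_all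
        then have vsN: "set vs \<subseteq> N" using vs by (fastforce simp: in_set_conv_nth)
        have "col (\<lambda>x. F (vs[j := x]))"
          using transfer[OF vs(1) vsN b] False j unfolding nc_def by blast
        from colD[OF this] have "(F (vs[j := zs ! j]), F (vs[j := ws ! j])) \<in> \<delta>"
          using zw[OF j] NU Nth by blast
        with IH show "(F zs, F (vs[j := ws ! j])) \<in> \<delta>" by (rule delta_trans)
      next
        show "(F zs, F zs) \<in> \<delta>" using delta_refl F_cl zs NU U_sub by blast
      qed
      then show ?thesis using Fq zs ws by simp
    qed
    then show ?thesis unfolding essentially_unary_def by blast
  next
    case True
    then obtain i where i: "i < n" "nc i b" by blast
    define h where "h x = F (b[i := x])" for x
    have h: "upoly Al h" unfolding h_def using F_u[OF b(1) bU] .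
    have hN: "h ` N \<subseteq> N" using Fq q_cl upd b by (auto simp: h_def)
    have "bij_betw h U U"
    proof (rule noncol_bij[OF h])
      show "h ` U \<subseteq> U" using F_cl upd b bU by (auto simp: h_def)
      show "\<not> col h" using i(2) unfolding nc_def h_def .
    qed
    from not_col_of_bij[OF h this]
    have hinj: "\<forall>x\<in>N. \<forall>y\<in>N. (h x, h y) \<in> \<delta> \<longrightarrow> (x, y) \<in> \<delta>" using Nth NU by blast
    have "(q zs, h (zs ! i)) \<in> \<delta>" if zs: "length zs = n" "set zs \<subseteq> N" for zs
    proof -
      \<comment> \<open>Only the entry at \<open>i\<close> is kept from \<open>zs\<close>, so the
        change at \<open>i\<close> is trivial and every other change is in a collapsing
        variable.\<close>
      let ?ws = "b[i := zs ! i]"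
      have zi: "zs ! i \<in> N" using zs i(1) nth_mem by blast
      have ws: "length ?ws = n" "set ?ws \<subseteq> N" using b upd zi by auto
      have "(F zs, F ?ws) \<in> \<delta>"
      proof (rule coordinatewise[of zs n ?ws "\<lambda>vs. (F zs, F vs) \<in> \<delta>", OF zs(1) ws(1)])
        fix j vs
        assume j: "j < n" and vs: "length vs = n" "\<forall>k<n. vs ! k = zs ! k \<or> vs ! k = ?ws ! k"
          and IH: "(F zs, F (vs[j := zs ! j])) \<in> \<delta>"
        have zw: "zs ! k \<in> N" "?ws ! k \<in> N" if "k < n" for k
      using subsetD[OF zs(2) nth_mem] subsetD[OF ws(2) nth_mem] zs(1) ws(1) that by simp_all
        then have vsN: "set vs \<subseteq> N" using vs by (fastforce simp: in_set_conv_nth)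
        show "(F zs, F (vs[j := ?ws ! j])) \<in> \<delta>"
        proof (cases "j = i")
          case True
          then show ?thesis using IH i(1) b(1) by simp
        next
          case False
          then have "col (\<lambda>x. F (vs[j := x]))"
            using transfer[OF vs(1) vsN b] uniq[OF i(2)] unfolding nc_def by blast
          from colD[OF this] have "(F (vs[j := zs ! j]), F (vs[j := ?ws ! j])) \<in> \<delta>"
            using zw[OF j] NU Nth by blast
          with IH show ?thesis by (rule delta_trans)
        qed
      next
        show "(F zs, F zs) \<in> \<delta>" using delta_refl F_cl zs NU U_sub by blast
      qed
      then show ?thesis using Fq zs by (simp add: h_def)
    qed
    with i(1) h hN hinj show ?thesis unfolding essentially_unary_def by blast
  qed
qed

text \<open>Induction trades the choice of representatives in \<open>quot\<close> for polynomials of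
  the algebra itself. The chosen representatives differ from the values of the lifts only by
  \<delta>, which polynomials preserve.\<close>

lemma polys_quot_lift:
  assumes N: "N \<subseteq> uni Al" and p: "p \<in> polys (quot (induced Al N) (restr \<delta> N)) n"
  shows "\<exists>q\<in>polys Al n. \<forall>zs. length zs = n \<and> set zs \<subseteq> N \<longrightarrow>
    q zs \<in> N \<and> p (map (\<lambda>z. restr \<delta> N `` {z}) zs) = restr \<delta> N `` {q zs}"
  using p
proof induction
  case (proj i)
  then show ?case by (intro bexI[OF _ polys.proj[of i]]) (auto simp: subset_code(1))
next
  case (const C)
  then have "C \<in> N // restr \<delta> N" by (simp add: quot_def induced_def)
  then obtain c where "c \<in> N" "C = restr \<delta> N `` {c}" by (rule quotientE)
  then show ?case using N by (intro bexI[OF _ polys.const[of c]]) auto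
next
  case (app k G gs)
  have eq: "equiv N (restr \<delta> N)" by (rule equiv_restr[OF equiv_delta N])
  obtain f where f: "f \<in> polys Al k" "\<And>xs. length xs = k \<Longrightarrow> set xs \<subseteq> N \<Longrightarrow> f xs \<in> N"
    and G: "G = (\<lambda>Cs. restr \<delta> N `` {f (map (\<lambda>C. SOME x. x \<in> C) Cs)})"
    using app(1) by (auto simp: quot_def induced_def)
  have "\<exists>Q. \<forall>g\<in>set gs. Q g \<in> polys Al n \<and> (\<forall>zs. length zs = n \<and> set zs \<subseteq> N \<longrightarrow>
      Q g zs \<in> N \<and> g (map (\<lambda>z. restr \<delta> N `` {z}) zs) = restr \<delta> N `` {Q g zs})"
    by (rule bchoice) (use app(3) in auto)
  then obtain Q where Q: "\<And>g. g \<in> set gs \<Longrightarrow> Q g \<in> polys Al n"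
    "\<And>g zs. g \<in> set gs \<Longrightarrow> length zs = n \<Longrightarrow> set zs \<subseteq> N \<Longrightarrow> Q g zs \<in> N"
    "\<And>g zs. g \<in> set gs \<Longrightarrow> length zs = n \<Longrightarrow> set zs \<subseteq> N \<Longrightarrow>
      g (map (\<lambda>z. restr \<delta> N `` {z}) zs) = restr \<delta> N `` {Q g zs}" by auto
  define q where "q zs = f (map (\<lambda>q. q zs) (map Q gs))" for zs
  have q: "q \<in> polys Al n"
    unfolding q_def using polys_comp[OF f(1), of "map Q gs" n] Q(1) app(2) by fastforce
  have "q zs \<in> N \<and> G (map (\<lambda>g. g (map (\<lambda>z. restr \<delta> N `` {z}) zs)) gs) = restr \<delta> N `` {q zs}"
    if zs: "length zs = n" "set zs \<subseteq> N" for zs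
  proof -
    let ?s = "\<lambda>g. SOME x. x \<in> g (map (\<lambda>z. restr \<delta> N `` {z}) zs)"
    have s: "(Q g zs, ?s g) \<in> restr \<delta> N" if g: "g \<in> set gs" for g
    proof -
      have "Q g zs \<in> g (map (\<lambda>z. restr \<delta> N `` {z}) zs)"
        using Q(3)[OF g zs] equiv_class_self[OF eq Q(2)[OF g zs]] by simp
      then have "?s g \<in> g (map (\<lambda>z. restr \<delta> N `` {z}) zs)" by (rule someI)
      then show ?thesis using Q(3)[OF g zs] by simp
    qed
    have qN: "q zs \<in> N" unfolding q_def by (rule f(2)) (use app(2) Q(2)[OF _ zs] in auto)
    have sN: "f (map ?s gs) \<in> N"
      by (rule f(2)) (use app(2) s in \<open>auto simp: restr_def\<close>)
    have "(q zs, f (map ?s gs)) \<in> \<delta>"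
      unfolding q_def
      by (rule polys_cong[OF Con_delta f(1)])
        (use app(2) s in \<open>auto simp: list_all2_conv_all_nth restr_def\<close>)
    with qN sN have "restr \<delta> N `` {q zs} = restr \<delta> N `` {f (map ?s gs)}"
      by (intro equiv_class_eq[OF eq]) (simp add: restr_def)
    then show ?thesis using qN by (simp add: G o_def)
  qed
  with q show ?case by blast
qed

text \<open>The witness is the group of all permutations of the quotient that are unary polynomials
  of it. Essential unarity reduces each polynomial of the quotient to a constant or to such a
  permutation of one variable; the converse holds by the choice of the group.\<close>

lemma type_one_of_essentially_unary:
  assumes N: "N \<in> traces Al \<delta> \<theta> U"
    and ess: "\<And>n q. q \<in> polys Al n \<Longrightarrow> (\<And>zs. length zs = n \<Longrightarrow> set zs \<subseteq> N \<Longrightarrow> q zs \<in> N) \<Longrightarrow>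
      essentially_unary N n q"
  shows "tct_type_one Al \<delta> \<theta>"
proof -
  note NU = trace_facts(1)[OF N] and N_ne = trace_facts(2)[OF N]
  define \<rho> where "\<rho> = restr \<delta> N"
  define X where "X = N // \<rho>"
  define M where "M = quot (induced Al N) \<rho>"
  \<comment> \<open>The same choice of representatives as in \<open>quot\<close>, so that
    \<open>H\<close> below is literally a fundamental operation of \<open>M\<close>.\<close>
  define sel where "sel C = (SOME x. x \<in> C)" for C :: "'a set"
  have N_uni: "N \<subseteq> uni Al" using NU U_sub by blast
  have eq: "equiv N \<rho>" unfolding \<rho>_def by (rule equiv_restr[OF equiv_delta N_uni])
  have uniM: "uni M = X" by (simp add: M_def quot_def induced_def X_def)
  have sel: "sel C \<in> N" "\<rho> `` {sel C} = C" if C: "C \<in> X" for C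
  proof -
    obtain x where x: "x \<in> N" "C = \<rho> `` {x}" using C unfolding X_def by (rule quotientE)
    then have "sel C \<in> C" unfolding sel_def using equiv_class_self[OF eq] by (metis someI)
    then have xs: "(x, sel C) \<in> \<rho>" using x by simp
    then show "sel C \<in> N" using eq by (auto simp: equiv_def)
    show "\<rho> `` {sel C} = C" using equiv_class_eq[OF eq xs] x by simp
  qed
  have cls: "\<rho> `` {x} = \<rho> `` {y} \<longleftrightarrow> (x, y) \<in> \<delta>" if "x \<in> N" "y \<in> N" for x y
    using eq_equiv_class_iff[OF eq that] that by (simp add: \<rho>_def restr_def)
  have clsX: "\<rho> `` {x} \<in> X" if "x \<in> N" for x unfolding X_def using that by (rule quotientI)
  have finX: "finite X" unfolding X_def
    using finite_quotient[of N \<rho>] finite_subset[OF NU U_fin] eq by (auto simp: equiv_def)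
  define G where "G = {g. bij_betw g X X \<and> (\<exists>P\<in>polys M 1. \<forall>C\<in>X. g C = P [C])}"
  define S where "S = gset_alg X G"
  have uniS: "uni S = X" by (simp add: S_def gset_alg_def)
  have algS: "is_algebra S"
  proof -
    have "g (hd xs) \<in> X" if "g \<in> G" "length xs = 1" "set xs \<subseteq> X" for g xs
      using that unfolding G_def by (cases xs) (auto dest: bij_betwE)
    moreover have "X \<noteq> {}" using N_ne clsX by blast
    ultimately show ?thesis unfolding is_algebra_def by (auto simp: S_def gset_alg_def)
  qed
  have to_S: "\<exists>p'\<in>polys S n. agree X n p p'" if p: "p \<in> polys M n" for p n
  proof -
    obtain q where q: "q \<in> polys Al n" "\<And>zs. length zs = n \<Longrightarrow> set zs \<subseteq> N \<Longrightarrow> q zs \<in> N"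
      "\<And>zs. length zs = n \<Longrightarrow> set zs \<subseteq> N \<Longrightarrow> p (map (\<lambda>z. \<rho> `` {z}) zs) = \<rho> `` {q zs}"
      using polys_quot_lift[OF N_uni p[unfolded M_def \<rho>_def]] unfolding \<rho>_def by blast
    have selN: "set (map sel Cs) \<subseteq> N" if "set Cs \<subseteq> X" for Cs using sel(1) that by auto
    have pq: "p Cs = \<rho> `` {q (map sel Cs)}" if "length Cs = n" "set Cs \<subseteq> X" for Cs
    proof -
      have "map (\<lambda>z. \<rho> `` {z}) (map sel Cs) = Cs"
        using sel(2) that(2) by (auto intro!: map_idI)
      then show ?thesis using q(3)[of "map sel Cs"] selN[OF that(2)] that(1) by simp
    qed
    have "essentially_unary N n q" by (rule ess[OF q(1)]) (rule q(2))
    then show ?thesis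
      unfolding essentially_unary_def
    proof (elim disjE exE conjE)
      assume const: "\<forall>zs ws. length zs = n \<and> set zs \<subseteq> N \<and> length ws = n \<and> set ws \<subseteq> N \<longrightarrow>
        (q zs, q ws) \<in> \<delta>"
      obtain c where c: "c \<in> N" using N_ne by blast
      let ?b = "replicate n c"
      have b: "length ?b = n" "set ?b \<subseteq> N" using c by auto
      have "agree X n p (\<lambda>xs. \<rho> `` {q ?b})"
        unfolding agree_def using pq selN q(2) b const cls by (metis length_map)
      moreover have "(\<lambda>xs. \<rho> `` {q ?b}) \<in> polys S n"
        by (rule polys.const) (simp only: uniS clsX q(2) b)
      ultimately show ?thesis by blast
    next
      fix i h
      assume i: "i < n" and h: "upoly Al h" "h ` N \<subseteq> N"
        and hinj: "\<forall>x\<in>N. \<forall>y\<in>N. (h x, h y) \<in> \<delta> \<longrightarrow> (x, y) \<in> \<delta>"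
        and qh: "\<forall>zs. length zs = n \<and> set zs \<subseteq> N \<longrightarrow> (q zs, h (zs ! i)) \<in> \<delta>"
      obtain ph where ph: "ph \<in> polys Al 1" "\<And>x. x \<in> N \<Longrightarrow> h x = ph [x]"
        using h(1) N_uni unfolding upoly_def by blast
      define g where "g C = \<rho> `` {h (sel C)}" for C
      have gX: "g ` X \<subseteq> X" using clsX h(2) sel(1) by (auto simp: g_def)
      have "inj_on g X"
      proof (rule inj_onI)
        fix C D assume CD: "C \<in> X" "D \<in> X" "g C = g D"
        then have "(h (sel C), h (sel D)) \<in> \<delta>"
          unfolding g_def using cls h(2) sel(1) by (metis image_subset_iff)
        then show "C = D" using hinj sel cls CD by metis
      qed
      then have bij: "bij_betw g X X" using endo_inj_surj[OF finX gX] by (simp add: bij_betw_def)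
      define H where "H Cs = \<rho> `` {ph (map sel Cs)}" for Cs
      \<comment> \<open>\<open>ph\<close> agrees with \<open>h\<close> on \<open>N\<close> and so
        preserves it, which is what the induced algebra asks of its operations.\<close>
      have "(1, ph) \<in> fops (induced Al N)"
      proof -
        have "ph xs \<in> N" if "length xs = 1" "set xs \<subseteq> N" for xs
          using that ph(2) h(2) by (cases xs) force+
        then show ?thesis using ph(1) by (simp add: induced_def)
      qed
      then have "(1, H) \<in> fops M"
        unfolding M_def quot_def H_def sel_def by auto
      then have H: "(\<lambda>Cs. H (map (\<lambda>g. g Cs) [\<lambda>xs. xs ! 0])) \<in> polys M 1"
        by (rule polys.app) (auto intro: polys.proj)
      have "g C = H (map (\<lambda>g. g [C]) [\<lambda>xs. xs ! 0])" if "C \<in> X" for C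
        using ph(2) sel(1)[OF that] by (simp add: g_def H_def)
      then have "g \<in> G" unfolding G_def using bij bexI[OF _ H] by simp
      then have "(1, \<lambda>xs. g (hd xs)) \<in> fops S" by (auto simp: S_def gset_alg_def)
      then have "(\<lambda>Cs. g (hd (map (\<lambda>g. g Cs) [\<lambda>xs. xs ! i]))) \<in> polys S n"
        by (rule polys.app) (use i in \<open>auto intro: polys.proj\<close>)
      moreover have "p Cs = g (Cs ! i)" if "length Cs = n" "set Cs \<subseteq> X" for Cs
      proof -
        have "sel (Cs ! i) \<in> N" using sel(1) that i nth_mem by blast
        moreover have "(q (map sel Cs), h (sel (Cs ! i))) \<in> \<delta>"
          using qh[rule_format, of "map sel Cs"] selN[OF that(2)] that(1) i by simp
        ultimately show ?thesis
          unfolding pq[OF that] g_def using cls q(2) selN[OF that(2)] that(1) h(2)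
          by (metis image_subset_iff length_map)
      qed
      ultimately show ?thesis unfolding agree_def by (intro bexI) auto
    qed
  qed
  have to_M: "\<exists>p'\<in>polys M n. agree X n p p'" if "p \<in> polys S n" for p n
    using that
  proof induction
    case (proj i)
    then show ?case by (intro bexI[OF _ polys.proj[of i]]) (auto simp: agree_def)
  next
    case (const c)
    then show ?case using uniS uniM by (intro bexI[OF _ polys.const[of c]]) (auto simp: agree_def)
  next
    \<comment> \<open>Every operation of \<open>S\<close> is unary, so \<open>gs\<close> is a
      singleton and the polynomial \<open>P\<close> representing \<open>g\<close> can be composed
      with it.\<close>
    case (app k f gs)
    obtain g where g: "g \<in> G" "f = (\<lambda>xs. g (hd xs))" "k = 1"
      using app(1) by (auto simp: S_def gset_alg_def)
    then obtain p1 where gs: "gs = [p1]" using app(2) by (cases gs) auto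
    obtain P where P: "P \<in> polys M 1" "\<And>C. C \<in> X \<Longrightarrow> g C = P [C]" using g(1) by (auto simp: G_def)
    obtain p2 where p2: "p2 \<in> polys M n" "agree X n p1 p2" using app(3) gs by auto
    have p1: "p1 \<in> polys S n" using app(3) gs by auto
    have "p1 Cs \<in> X" if "length Cs = n" "set Cs \<subseteq> X" for Cs
      using polys_closed[OF algS p1 that(1)] that(2) uniS by simp
    moreover have "(\<lambda>Cs. P (map (\<lambda>q. q Cs) [p2])) \<in> polys M n"
      by (rule polys_comp[OF P(1)]) (use p2 in auto)
    ultimately show ?case
      using P(2) p2(2) by (intro bexI) (auto simp: agree_def g(2) gs)
  qed
  have agree_trans: "agree X n f p'" if "agree X n f p" "agree X n p p'" for f p p' n
    using that by (simp add: agree_def)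
  have "poly_equiv M S"
    unfolding poly_equiv_def uniM uniS using to_S to_M agree_trans by blast
  moreover have "is_Gset X G" by (simp add: is_Gset_def G_def)
  ultimately show ?thesis
    unfolding tct_type_one_def using min N unfolding M_def S_def X_def \<rho>_def by blast
qed

text \<open>A failure of the unit condition of \<open>no_units\<close> at \<open>y\<close> yields
  the \<open>nonunit\<close> condition there, because noncollapsing sections permute
  \<open>U\<close>. The empty tail supplies a trace through \<open>y\<close>, on which all
  polynomials are then essentially unary, forcing type 1.\<close>

lemma tail_nonempty:
  assumes pent: "is_pentagon Al \<gamma> \<delta> \<theta>" and type: "\<not> tct_type_one Al \<delta> \<theta>"
  shows "tail Al \<delta> \<theta> U \<noteq> {}"
proof
  assume tail: "tail Al \<delta> \<theta> U = {}"
  show False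
  proof (rule no_units[OF pent], rule ccontr)
    fix y
    assume y: "y \<in> U" and n: "\<nexists>f. bpoly Al f \<and> (\<forall>x\<in>U. \<forall>z\<in>U. f x z \<in> U) \<and>
      bij_betw (\<lambda>x. f x y) U U \<and> bij_betw (\<lambda>x. f y x) U U"
    obtain N where N: "N \<in> traces Al \<delta> \<theta> U" "y \<in> N"
      using tail y by (auto simp: tail_def body_def)
    have "col (\<lambda>x. f x y) \<or> col (\<lambda>z. f y z)"
      if f: "bpoly Al f" "\<forall>x\<in>U. \<forall>z\<in>U. f x z \<in> U" for f
    proof (rule ccontr)
      assume "\<not> ?thesis"
      then have "bij_betw (\<lambda>x. f x y) U U" "bij_betw (\<lambda>x. f y x) U U"
        using noncol_bij[OF bpoly_section1[OF f(1) y]] noncol_bij[OF bpoly_section2[OF f(1) y]]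
          f(2) y by blast+
      with n f show False by blast
    qed
    moreover have "\<not> col (\<lambda>x. f x d)"
      if "bpoly Al f" "\<forall>x\<in>U. \<forall>z\<in>U. f x z \<in> U" "c \<in> U" "d \<in> U" "(c, d) \<in> \<theta>" "\<not> col (\<lambda>x. f x c)"
      for f c d
      by (rule no_twin[OF tail pent that(1) _ that(3-)]) (use that(2) in blast)
    ultimately have "essentially_unary N n q"
      if "q \<in> polys Al n" "\<And>zs. length zs = n \<Longrightarrow> set zs \<subseteq> N \<Longrightarrow> q zs \<in> N" for n q
      using essentially_unary_polys[OF N _ _ that] by blast
    with type_one_of_essentially_unary[OF N(1)] type show False by blast
  qed
qed

end

theorem theorem2p1:
  fixes Al :: "'a alg" and \<gamma> \<delta> \<theta> :: "'a rel" and U :: "'a set"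
  assumes "finite_algebra Al"
    and "is_pentagon Al \<gamma> \<delta> \<theta>"
    and "covers Al \<delta> \<theta>"
    and "\<not> tct_type_one Al \<delta> \<theta>"
    and "min_set Al \<delta> \<theta> U"
  shows "tail Al \<delta> \<theta> U \<noteq> {}"
proof -
  interpret minimal_set Al \<delta> \<theta> U
    using assms by unfold_locales
  show ?thesis using tail_nonempty assms(2,4) .
qed

end
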